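(* Let $n\ge 1$. The operator $W([n])$ is a well-defined operator on $\mathbb{C}[p_1,p_2,\dots]$ (it maps this subring of $\mathbb{C}[[X_{ab}]]_{a,b\ge1}$ into itself), and on $\mathbb{C}[p_1,p_2,\dots]$ it can be written as the sum of $n!$ summations $$W([n])=\sum_{\alpha\in S_n} FS_\alpha ,$$ one summation $FS_\alpha$ for each quiver $\hat Q_\alpha$, or equivalently for each permutation $\alpha\in S_n$.
   Context: **The operator $W([n])$.** Let $X=(X_{ab})_{a,b\ge 1}$ be the infinite matrix whose entries are independent variables, and for $k\ge1$ let $p_k=\mathrm{Tr}(X^k)=\sum_{a_1,\dots,a_k\ge1}X_{a_1a_k}X_{a_ka_{k-1}}\cdots X_{a_2a_1}\in\mathbb{C}[[X_{ab}]]_{a,b\ge1}$. The $p_k$ are algebraically independent, and $\mathbb{C}[p_1,p_2,\dots]$ is regarded as a subring of $\mathbb{C}[[X_{ab}]]$. Let $D_{ab}=\sum_{c\ge1}X_{ac}\frac{\partial}{\partial X_{bc}}$. The normal ordered product $:\ :$ means that all differentiations are performed first, with all $X$'s to the left: with $a_{n+1}:=a_1$, $$:D_{a_1a_n}D_{a_na_{n-1}}\cdots D_{a_2a_1}:\;=\sum_{e_1,\dots,e_n\ge1}\Big(\prod_{i=1}^nX_{a_{i+1}e_i}\Big)\prod_{i=1}^n\frac{\partial}{\partial X_{a_ie_i}} .$$ Define $W([n])=\frac1n\sum_{a_1,\dots,a_n\ge1}:D_{a_1a_n}D_{a_na_{n-1}}\cdots D_{a_2a_1}:$. **The quiver $\hat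 Q_\alpha$.** For $\alpha\in S_n$, $\hat Q_\alpha$ is the directed graph with vertices $1,\dots,n+1$ and arrows $i\to\alpha(i)$ for $2\le i\le n$ together with $n+1\to\alpha(1)$. It consists of one chain, from $n+1$ to $1$, and possibly some loops (directed cycles, a vertex with a self-arrow being allowed). Each $t\in\{1,\dots,n\}$ is the target of exactly one arrow. One recovers $\alpha$ from $\hat Q_\alpha$ by replacing $n+1$ by $1$. **The permutations $[\alpha,j]\in S_{n+1}$.** For $\alpha\in S_n$ and $0\le j\le n$, $[\alpha,j]$ is the permutation $\beta\in S_{n+1}$ whose quiver $\hat Q_\beta$ (on vertices $1,\dots,n+2$) is obtained from $\hat Q_\alpha$ as follows. If $j=0$: add the vertex $n+2$ and the arrow $n+2\to n+1$. If $j\ge1$: let $i\to j$ be the unique arrow of $\hat Q_\alpha$ with target $j$; delete it, add the vertex $n+2$, and add the arrows $n+2\to j$ and $i\to n+1$. Every element of $S_{n+1}$ is $[\alpha,j]$ for exactly one pair $(\alpha,j)$. **The summations $FS_\alpha$.** Define recursively a set partition $\pi_\alpha$ of $\{1,\dots,n\}$ for $\alpha\in S_n$: for the unique element $(1)\in S_1$, $\pi_{(1)}=\{\{1\}\}$; $\pi_{[\alpha,0]}=\pi_\alpha\cup\{\{n+1\}\}$; for $1\le j\le n$, $\pi_{[\alpha,j]}$ is obtained from $\pi_\alpha$ by adding $n+1$ to the block containing $j$. For $k_1,\dots,k_n\ge1$ and $B\subseteq\{1,\dots,n\}$ put $k_B=\sum_{t\in B}k_t$. Let $$FS'_\alpha=\sum_{k_1,\dots,k_n\ge1}\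 \Big(\prod_{s\to t\text{ arrow of }\hat Q_\alpha}(X^{k_t})_{a_sa_t}\Big)\prod_{B\in\pi_\alpha}k_B\frac{\partial}{\partial p_{k_B}} .$$ $FS_\alpha$ is $\frac1n$ times the result of setting $a_{n+1}=a_1$ in $FS'_\alpha$ and summing over $a_1,\dots,a_n\ge1$, i.e. $$FS_\alpha=\frac1n\sum_{k_1,\dots,k_n\ge1}\ \Big(\prod_{c}p_{k_c}\Big)\prod_{B\in\pi_\alpha}k_B\frac{\partial}{\partial p_{k_B}},$$ where $c$ runs over the (supports of the) disjoint cycles of $\alpha$, fixed points included, and all derivatives are applied before multiplication by the $p$'s. *)

theory Defs
  imports
    Complex_Main
    "HOL-Library.Multiset"
    "HOL-Library.FuncSet"
    "HOL-Library.Poly_Mapping"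
    "HOL-Combinatorics.Orbits"
begin

section \<open>Formal power series in arbitrarily many variables\<close>

text \<open>
  A monomial is a finite multiset of variables, and a power series is an arbitrary function from
  monomials to coefficients.
\<close>

typedef 'v mfps = "UNIV :: ('v multiset \<Rightarrow> complex) set"
  morphisms coef Mfps ..

setup_lifting type_definition_mfps

lemma coef_Mfps [simp]: "coef (Mfps f) = f"
  by (simp add: Mfps_inverse)

lemma mfps_eqI: "(\<And>m. coef f m = coef g m) \<Longrightarrow> f = g"
  by (simp add: coef_inject [symmetric] fun_eq_iff)

definition splits :: "'v multiset \<Rightarrow> ('v multiset \<times> 'v multiset) set" where
  "splits m = {(a, b). a + b = m}"

lemma finite_submultisets: "finite {a. a \<subseteq># (m :: 'v multiset)}"
proof (induction m)
  case (add x m)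
  have "{a. a \<subseteq># add_mset x m} \<subseteq> {a. a \<subseteq># m} \<union> add_mset x ` {a. a \<subseteq># m}"
  proof
    fix a assume "a \<in> {a. a \<subseteq># add_mset x m}"
    hence a: "a \<subseteq># add_mset x m" by simp
    show "a \<in> {a. a \<subseteq># m} \<union> add_mset x ` {a. a \<subseteq># m}"
    proof (cases "x \<in># a")
      case True
      then obtain b where "a = add_mset x b" by (metis multi_member_split)
      thus ?thesis using a by auto
    next
      case False
      thus ?thesis using a by (metis UnCI mem_Collect_eq diff_single_trivial
          subset_eq_diff_conv add_mset_add_single)
    qed
  qed
  thus ?case using add by (meson finite_UnI finite_imageI finite_subset)
qed simp

lemma finite_splits [simp]: "finite (splits m)"
proof (rule finite_subset)
  show "splits m \<subseteq> {a. a \<subseteq># m} \<times> {a. a \<subseteq># m}"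
    by (auto simp: splits_def)
qed (simp add: finite_submultisets)

instantiation mfps :: (type) comm_ring_1
begin

definition zero_mfps :: "'a mfps" where "0 = Mfps (\<lambda>_. 0)"
definition one_mfps :: "'a mfps" where "1 = Mfps (\<lambda>m. if m = {#} then 1 else 0)"
definition plus_mfps :: "'a mfps \<Rightarrow> 'a mfps \<Rightarrow> 'a mfps" where
  "f + g = Mfps (\<lambda>m. coef f m + coef g m)"
definition minus_mfps :: "'a mfps \<Rightarrow> 'a mfps \<Rightarrow> 'a mfps" where
  "f - g = Mfps (\<lambda>m. coef f m - coef g m)"
definition uminus_mfps :: "'a mfps \<Rightarrow> 'a mfps" where
  "- f = Mfps (\<lambda>m. - coef f m)"
definition times_mfps :: "'a mfps \<Rightarrow> 'a mfps \<Rightarrow> 'a mfps" where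
  "f * g = Mfps (\<lambda>m. \<Sum>(a, b)\<in>splits m. coef f a * coef g b)"

instance
proof
  fix f g h :: "'a mfps"
  show "f * g * h = f * (g * h)"
  proof (rule mfps_eqI)
    fix m
    have "coef (f * g * h) m =
        (\<Sum>(p, q)\<in>(SIGMA x:splits m. splits (fst x)).
           coef f (fst q) * coef g (snd q) * coef h (snd p))"
      by (simp add: times_mfps_def sum_distrib_right case_prod_unfold sum.Sigma)
    also have "\<dots> = (\<Sum>(p, q)\<in>(SIGMA x:splits m. splits (snd x)).
           coef f (fst p) * (coef g (fst q) * coef h (snd q)))"
      by (rule sum.reindex_bij_witness
          [where i = "\<lambda>(p, q). ((fst p + fst q, snd q), (fst p, fst q))"
             and j = "\<lambda>(p, q). ((fst q, snd q + snd p), (snd q, snd p))"])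
         (auto simp: splits_def algebra_simps)
    also have "\<dots> = coef (f * (g * h)) m"
      by (simp add: times_mfps_def sum_distrib_left case_prod_unfold sum.Sigma)
    finally show "coef (f * g * h) m = coef (f * (g * h)) m" .
  qed
  show "f * g = g * f"
  proof (rule mfps_eqI)
    fix m
    show "coef (f * g) m = coef (g * f) m"
      unfolding times_mfps_def coef_Mfps
      by (rule sum.reindex_bij_witness [where i = prod.swap and j = prod.swap])
         (auto simp: splits_def algebra_simps)
  qed
  show "1 * f = f"
  proof (rule mfps_eqI)
    fix m
    have "coef (1 * f) m = (\<Sum>x\<in>splits m. if x = ({#}, m) then coef f m else 0)"
      unfolding times_mfps_def one_mfps_def coef_Mfps
      by (rule sum.cong) (auto simp: splits_def split: if_splits)
    also have "\<dots> = coef f m"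
      using finite_splits [of m] by (subst sum.delta) (simp_all, simp add: splits_def)
    finally show "coef (1 * f) m = coef f m" .
  qed
  show "(f + g) * h = f * h + g * h"
    by (rule mfps_eqI)
       (simp add: times_mfps_def plus_mfps_def case_prod_unfold sum.distrib algebra_simps)
  have "coef (0 :: 'a mfps) {#} \<noteq> coef 1 {#}"
    by (simp add: zero_mfps_def one_mfps_def)
  thus "(0 :: 'a mfps) \<noteq> 1" by metis
qed (simp_all add: plus_mfps_def minus_mfps_def uminus_mfps_def zero_mfps_def algebra_simps
       coef_inverse)

end

definition mconst :: "complex \<Rightarrow> 'v mfps" where
  "mconst c = Mfps (\<lambda>m. if m = {#} then c else 0)"

definition mvar :: "'v \<Rightarrow> 'v mfps" where
  "mvar v = Mfps (\<lambda>m. if m = {#v#} then 1 else 0)"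

definition mderiv :: "'v \<Rightarrow> 'v mfps \<Rightarrow> 'v mfps" where
  "mderiv v f = Mfps (\<lambda>m. of_nat (count m v + 1) * coef f (add_mset v m))"

text \<open>
  Infinite sums of power series are taken coefficientwise. They are meaningful if every
  coefficient receives only finitely many nonzero contributions.
\<close>

definition locally_finite :: "'i set \<Rightarrow> ('i \<Rightarrow> 'v mfps) \<Rightarrow> bool" where
  "locally_finite A g \<longleftrightarrow> (\<forall>m. finite {i \<in> A. coef (g i) m \<noteq> 0})"

definition fsum :: "'i set \<Rightarrow> ('i \<Rightarrow> 'v mfps) \<Rightarrow> 'v mfps" where
  "fsum A g = Mfps (\<lambda>m. \<Sum>i \<in> {i \<in> A. coef (g i) m \<noteq> 0}. coef (g i) m)"

lemma coef_times: "coef (f * g) m = (\<Sum>(a, b)\<in>splits m. coef f a * coef g b)"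
  by (simp add: times_mfps_def)

lemma coef_times_nonzeroE:
  assumes "coef (f * g) m \<noteq> 0"
  obtains a b where "m = a + b" "coef f a \<noteq> 0" "coef g b \<noteq> 0"
proof -
  have "\<exists>x\<in>splits m. (case x of (a, b) \<Rightarrow> coef f a * coef g b) \<noteq> 0"
    using assms unfolding coef_times by (rule sum.not_neutral_contains_not_neutral) blast
  thus ?thesis using that by (auto simp: splits_def)
qed

lemma coef_prod_mvar_nonzero:
  assumes "finite I" "coef (\<Prod>i\<in>I. mvar (v i)) m \<noteq> 0"
  shows "m = image_mset v (mset_set I)"
  using assms
proof (induction I arbitrary: m rule: finite_induct)
  case empty
  thus ?case by (simp add: one_mfps_def split: if_splits)
next
  case (insert x I)
  have "coef (mvar (v x) * (\<Prod>i\<in>I. mvar (v i))) m \<noteq> 0"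
    using insert.prems insert.hyps by simp
  then obtain a b where m: "m = a + b" and a: "coef (mvar (v x)) a \<noteq> 0"
      and b: "coef (\<Prod>i\<in>I. mvar (v i)) b \<noteq> 0"
    by (rule coef_times_nonzeroE)
  have "a = {#v x#}" using a by (simp add: mvar_def split: if_splits)
  moreover have "b = image_mset v (mset_set I)" using b by (rule insert.IH)
  moreover have "mset_set (insert x I) = add_mset x (mset_set I)"
    using insert.hyps by (rule mset_set.insert)
  ultimately show ?case unfolding m by simp
qed

lemma coef_prod_mvar_times_nonzero:
  assumes "finite I" "coef ((\<Prod>i\<in>I. mvar (v i)) * f) m \<noteq> 0"
  shows "v ` I \<subseteq> set_mset m"
proof -
  obtain a b where ab: "m = a + b" "coef (\<Prod>i\<in>I. mvar (v i)) a \<noteq> 0"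
    using assms(2) by (rule coef_times_nonzeroE)
  have "a = image_mset v (mset_set I)"
    using assms(1) ab(2) by (rule coef_prod_mvar_nonzero)
  thus ?thesis using assms(1) ab(1) by simp
qed

lemma coef_fsum_nonzero:
  assumes "coef (fsum A g) m \<noteq> 0"
  obtains i where "i \<in> A" "coef (g i) m \<noteq> 0"
proof -
  obtain i where "i \<in> {i \<in> A. coef (g i) m \<noteq> 0}"
    using assms unfolding fsum_def coef_Mfps by (rule sum.not_neutral_contains_not_neutral)
  thus ?thesis using that by blast
qed


section \<open>The traces and the ring they generate\<close>

text \<open>
  The rows and columns of the infinite matrix are labelled by all naturals; the labels only serve
  to tell them apart. The entry in row \<open>a\<close> and column \<open>b\<close> is the variable \<open>(a, b)\<close>.
\<close>

type_synonym xseries = "(nat \<times> nat) mfps"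

text \<open>
  The successor of \<open>i\<close> in the cyclic convention \<open>a\<^bsub>n+1\<^esub> = a\<^sub>1\<close>.
\<close>

definition cyc :: "nat \<Rightarrow> nat \<Rightarrow> nat" where
  "cyc n i = (if i = n then 1 else i + 1)"

definition psum :: "nat \<Rightarrow> xseries" where
  "psum k = fsum ({1..k} \<rightarrow>\<^sub>E UNIV) (\<lambda>a. \<Prod>i\<in>{1..k}. mvar (a (cyc k i), a i))"

lemma finite_PiE_bounded:
  assumes "finite I" "finite S" "\<And>a i. a \<in> I \<rightarrow>\<^sub>E T \<Longrightarrow> P a \<Longrightarrow> i \<in> I \<Longrightarrow> a i \<in> S"
  shows "finite {a \<in> I \<rightarrow>\<^sub>E T. P a}"
proof (rule finite_subset)
  show "{a \<in> I \<rightarrow>\<^sub>E T. P a} \<subseteq> I \<rightarrow>\<^sub>E S"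
  proof
    fix a assume "a \<in> {a \<in> I \<rightarrow>\<^sub>E T. P a}"
    hence a: "a \<in> I \<rightarrow>\<^sub>E T" "P a" by simp_all
    show "a \<in> I \<rightarrow>\<^sub>E S"
      using assms(3) [OF a] PiE_arb [OF a(1)] by (rule PiE_I)
  qed
  show "finite (I \<rightarrow>\<^sub>E S)" using assms by (simp add: finite_PiE)
qed

lemma cyc_surj: "i \<in> {1..n} \<Longrightarrow> \<exists>j\<in>{1..n}. cyc n j = i"
  by (rule bexI [where x = "if i = 1 then n else i - 1"]) (auto simp: cyc_def)

lemma locally_finite_psum:
  "locally_finite ({1..k} \<rightarrow>\<^sub>E UNIV) (\<lambda>a. \<Prod>i\<in>{1..k}. mvar (a (cyc k i), a i :: nat))"
  unfolding locally_finite_def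
proof (rule allI, rule finite_PiE_bounded)
  fix m a i assume i: "i \<in> {1..k}" and "coef (\<Prod>i\<in>{1..k}. mvar (a (cyc k i), a i :: nat)) m \<noteq> 0"
  hence "(\<lambda>i. (a (cyc k i), a i)) ` {1..k} \<subseteq> set_mset m"
    by (intro coef_prod_mvar_times_nonzero [where f = 1]) simp_all
  thus "a i \<in> snd ` set_mset m" using i by (metis (no_types, lifting) image_subset_iff imageI snd_conv)
qed simp_all

text \<open>
  Polynomials in indeterminates indexed by naturals; a monomial is a multiset of indices. The
  carrier \<open>ppolys\<close> is the polynomial ring in the indeterminates with index \<open>\<ge> 1\<close>, the
  \<open>k\<close>-th of which stands for \<open>psum k\<close>.
\<close>

type_synonym ppoly = "nat multiset \<Rightarrow>\<^sub>0 complex"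

definition ppolys :: "ppoly set" where
  "ppolys = {F. \<forall>l\<in>Poly_Mapping.keys F. 0 \<notin># l}"

definition pvar :: "nat \<Rightarrow> ppoly" where
  "pvar k = Poly_Mapping.single {#k#} 1"

lift_definition pdiff :: "nat \<Rightarrow> ppoly \<Rightarrow> ppoly" is
  "\<lambda>k F l. of_nat (count l k + 1) * F (add_mset k l)"
proof -
  fix k and F :: "nat multiset \<Rightarrow> complex"
  assume "finite {l. F l \<noteq> 0}"
  hence "finite (add_mset k -` {l. F l \<noteq> 0})"
    by (rule finite_vimageI) (auto simp: inj_def)
  thus "finite {l. of_nat (count l k + 1) * F (add_mset k l) \<noteq> 0}"
    by (rule rev_finite_subset) auto
qed

definition ev :: "ppoly \<Rightarrow> xseries" where
  "ev F = (\<Sum>l\<in>Poly_Mapping.keys F. mconst (Poly_Mapping.lookup F l) * (\<Prod>k\<in>#l. psum k))"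

text \<open>
  The subring \<open>\<complex>[p\<^sub>1, p\<^sub>2, \<dots>]\<close> of the power series ring. As the \<open>psum k\<close> are algebraically
  independent, its elements correspond to polynomials, and an operator involving the
  \<open>\<partial>/\<partial>p\<^sub>k\<close> is given on the polynomials \<open>F\<close> representing the elements \<open>ev F\<close>.
\<close>

definition pring :: "xseries set" where
  "pring = ev ` ppolys"


section \<open>The operator \<open>W([n])\<close>\<close>

definition normal_D :: "nat \<Rightarrow> (nat \<Rightarrow> nat) \<Rightarrow> xseries \<Rightarrow> xseries" where
  "normal_D n a f = fsum ({1..n} \<rightarrow>\<^sub>E UNIV)
     (\<lambda>e. (\<Prod>i\<in>{1..n}. mvar (a (cyc n i), e i)) * fold (\<lambda>i. mderiv (a i, e i)) [1..<n+1] f)"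

definition Wop :: "nat \<Rightarrow> xseries \<Rightarrow> xseries" where
  "Wop n f = mconst (1 / of_nat n) * fsum ({1..n} \<rightarrow>\<^sub>E UNIV) (\<lambda>a. normal_D n a f)"

text \<open>
  Both infinite sums are meaningful on arbitrary power series.
\<close>

lemma locally_finite_normal_D:
  "locally_finite ({1..n} \<rightarrow>\<^sub>E UNIV) (\<lambda>e. (\<Prod>i\<in>{1..n}. mvar (a (cyc n i) :: nat, e i :: nat)) * g e)"
  unfolding locally_finite_def
proof (rule allI, rule finite_PiE_bounded)
  fix m e i assume i: "i \<in> {1..n}"
    and "coef ((\<Prod>i\<in>{1..n}. mvar (a (cyc n i), e i)) * g e) m \<noteq> 0"
  hence "(\<lambda>i. (a (cyc n i), e i)) ` {1..n} \<subseteq> set_mset m"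
    by (intro coef_prod_mvar_times_nonzero) simp_all
  thus "e i \<in> snd ` set_mset m" using i by (metis (no_types, lifting) image_subset_iff imageI snd_conv)
qed simp_all

lemma locally_finite_Wop: "locally_finite ({1..n} \<rightarrow>\<^sub>E UNIV) (\<lambda>a. normal_D n a f)"
  unfolding locally_finite_def
proof (rule allI, rule finite_PiE_bounded)
  fix m a i assume i: "i \<in> {1..n}" and a: "coef (normal_D n a f) m \<noteq> 0"
  obtain e where "coef ((\<Prod>i\<in>{1..n}. mvar (a (cyc n i), e i)) *
      fold (\<lambda>i. mderiv (a i, e i)) [1..<n+1] f) m \<noteq> 0"
    using a unfolding normal_D_def by (rule coef_fsum_nonzero)
  hence "(\<lambda>i. (a (cyc n i), e i)) ` {1..n} \<subseteq> set_mset m"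
    by (intro coef_prod_mvar_times_nonzero) simp_all
  moreover obtain j where "j \<in> {1..n}" "cyc n j = i"
    using cyc_surj i by blast
  ultimately have "(a i, e j) \<in> set_mset m" by blast
  thus "a i \<in> fst ` set_mset m" by (metis imageI fst_conv)
qed simp_all


section \<open>Quivers, the permutations \<open>[\<alpha>, j]\<close> and the set partitions \<open>\<pi>\<^sub>\<alpha>\<close>\<close>

text \<open>
  Elements of \<open>S\<^sub>n\<close> are functions \<open>\<alpha>\<close> with \<^term>\<open>\<alpha> permutes {1..n}\<close>; a quiver is represented by
  its set of arrows.
\<close>

definition quiver :: "nat \<Rightarrow> (nat \<Rightarrow> nat) \<Rightarrow> (nat \<times> nat) set" where
  "quiver n \<alpha> = {(i, \<alpha> i) | i. 2 \<le> i \<and> i \<le> n} \<union> {(n + 1, \<alpha> 1)}"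

definition quiver_ext :: "nat \<Rightarrow> (nat \<times> nat) set \<Rightarrow> nat \<Rightarrow> (nat \<times> nat) set" where
  "quiver_ext n Q j =
     (if j = 0 then Q \<union> {(n + 2, n + 1)}
      else let i = (THE i. (i, j) \<in> Q) in Q - {(i, j)} \<union> {(n + 2, j), (i, n + 1)})"

definition bracket :: "nat \<Rightarrow> (nat \<Rightarrow> nat) \<Rightarrow> nat \<Rightarrow> (nat \<Rightarrow> nat)" where
  "bracket n \<alpha> j =
     (THE \<beta>. \<beta> permutes {1..n+1} \<and> quiver (n + 1) \<beta> = quiver_ext n (quiver n \<alpha>) j)"

lemma in_quiver_iff:
  "(x, y) \<in> quiver n \<alpha> \<longleftrightarrow> (2 \<le> x \<and> x \<le> n \<and> y = \<alpha> x) \<or> (x = n + 1 \<and> y = \<alpha> 1)"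
  by (auto simp: quiver_def)

lemma quiver_inj:
  assumes "\<beta> permutes {1..n}" "\<beta>' permutes {1..n}" "quiver n \<beta> = quiver n \<beta>'"
  shows "\<beta> = \<beta>'"
proof
  fix i
  consider "i = 1" | "2 \<le> i \<and> i \<le> n" | "i \<notin> {1..n}" by fastforce
  thus "\<beta> i = \<beta>' i"
  proof cases
    case 1
    have "(n + 1, \<beta> 1) \<in> quiver n \<beta>'"
      unfolding assms(3) [symmetric] by (simp add: in_quiver_iff)
    thus ?thesis using 1 by (auto simp: in_quiver_iff)
  next
    case 2
    have "(i, \<beta> i) \<in> quiver n \<beta>'"
      unfolding assms(3) [symmetric] using 2 by (simp add: in_quiver_iff)
    thus ?thesis using 2 by (auto simp: in_quiver_iff)
  next
    case 3
    thus ?thesis using assms(1,2) by (simp add: permutes_def)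
  qed
qed

lemma quiver_ext_eq:
  fixes n j \<alpha>
  defines "\<beta> \<equiv> transpose (if j = 0 then n + 1 else j) (n + 1) \<circ> \<alpha> \<circ> transpose 1 (n + 1)"
  assumes "n \<ge> 1" "\<alpha> permutes {1..n}" "j \<le> n"
  shows "\<beta> permutes {1..n+1}" "quiver (n + 1) \<beta> = quiver_ext n (quiver n \<alpha>) j"
proof -
  have \<alpha>: "\<alpha> permutes {1..n+1}"
    using assms(3) by (rule permutes_subset) auto
  show "\<beta> permutes {1..n+1}"
    unfolding \<beta>_def using assms(2,4)
    by (intro permutes_compose permutes_swap_id \<alpha>) auto
  have out: "\<alpha> (Suc n) = Suc n" using assms(3) by (auto simp: permutes_def)
  have inn: "\<alpha> i \<in> {1..n}" if "i \<in> {1..n}" for i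
    using assms(3) that by (simp only: permutes_in_image)
  have inj: "\<alpha> i = \<alpha> i' \<Longrightarrow> i = i'" for i i'
    using assms(3) by (metis permutes_inverses(2))
  show "quiver (n + 1) \<beta> = quiver_ext n (quiver n \<alpha>) j"
  proof (cases "j = 0")
    case True
    have "\<beta> i = \<alpha> i" if "2 \<le> i" "i \<le> n" for i
      using that True by (simp add: \<beta>_def transpose_def)
    moreover have "\<beta> 1 = n + 1" "\<beta> (n + 1) = \<alpha> 1"
      using True assms(2) out by (auto simp: \<beta>_def transpose_def)
    ultimately show ?thesis using True assms(2)
      by (auto simp: quiver_def quiver_ext_def le_Suc_eq)
  next
    case False
    have \<beta>i: "\<beta> i = (if \<alpha> i = j then n + 1 else \<alpha> i)" if "2 \<le> i" "i \<le> n" for i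
      using that False inn [of i] by (auto simp: \<beta>_def transpose_def)
    have \<beta>1: "\<beta> 1 = j" "\<beta> (n + 1) = (if \<alpha> 1 = j then n + 1 else \<alpha> 1)"
      using False assms(2) out inn [of 1] by (auto simp: \<beta>_def transpose_def)
    obtain i0 where i0: "i0 \<in> {1..n}" "\<alpha> i0 = j"
      using assms(3,4) False by (metis permutes_inverses(1) permutes_in_image permutes_inv
          One_nat_def Suc_leI atLeastAtMost_iff bot_nat_0.not_eq_extremum)
    have key: "\<alpha> x = j \<longleftrightarrow> x = i0" and key': "j = \<alpha> x \<longleftrightarrow> x = i0" for x
      using i0(2) inj by metis+
    define i where "i = (if i0 = 1 then n + 1 else i0)"
    have arrow: "(i', j) \<in> quiver n \<alpha> \<longleftrightarrow> i' = i" for i'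
      unfolding in_quiver_iff key' i_def using i0(1) by auto
    have ext: "quiver_ext n (quiver n \<alpha>) j =
        quiver n \<alpha> - {(i, j)} \<union> {(n + 2, j), (i, n + 1)}"
      using False by (simp add: quiver_ext_def arrow)
    have q': "(x, y) \<in> quiver (n + 1) \<beta> \<longleftrightarrow>
        (2 \<le> x \<and> x \<le> n \<and> y = (if \<alpha> x = j then n + 1 else \<alpha> x)) \<or>
        (x = n + 1 \<and> y = (if \<alpha> 1 = j then n + 1 else \<alpha> 1)) \<or> (x = n + 2 \<and> y = j)" for x y
    proof -
      have "(x, y) \<in> quiver (n + 1) \<beta> \<longleftrightarrow>
          (2 \<le> x \<and> x \<le> n \<and> y = \<beta> x) \<or> (x = n + 1 \<and> y = \<beta> (n + 1)) \<or> (x = n + 2 \<and> y = \<beta> 1)"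
        using assms(2) by (auto simp: in_quiver_iff le_Suc_eq)
      moreover have "(2 \<le> x \<and> x \<le> n \<and> y = \<beta> x) \<longleftrightarrow>
          (2 \<le> x \<and> x \<le> n \<and> y = (if \<alpha> x = j then n + 1 else \<alpha> x))"
        using \<beta>i [of x] by metis
      ultimately show ?thesis unfolding \<beta>1 by (simp only:)
    qed
    show ?thesis
    proof (rule set_eqI, clarify)
      fix x y
      have ne: "\<alpha> z \<noteq> j" if "z \<noteq> i0" for z using that key by simp
      have rhs: "(x, y) \<in> quiver_ext n (quiver n \<alpha>) j \<longleftrightarrow>
          ((2 \<le> x \<and> x \<le> n \<and> y = \<alpha> x) \<or> (x = n + 1 \<and> y = \<alpha> 1)) \<and> \<not> (x = i \<and> y = j) \<or>
          (x = n + 2 \<and> y = j) \<or> (x = i \<and> y = n + 1)"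
        unfolding ext by (auto simp: in_quiver_iff)
      show "(x, y) \<in> quiver (n + 1) \<beta> \<longleftrightarrow> (x, y) \<in> quiver_ext n (quiver n \<alpha>) j"
        unfolding q' rhs i_def
        using i0 ne [of x] ne [of 1]
        by (cases "i0 = 1"; cases "x = i0"; cases "x = n + 1") auto
    qed
  qed
qed

lemma bracket_eq:
  assumes "n \<ge> 1" "\<alpha> permutes {1..n}" "j \<le> n"
  shows "bracket n \<alpha> j =
     transpose (if j = 0 then n + 1 else j) (n + 1) \<circ> \<alpha> \<circ> transpose 1 (n + 1)"
  unfolding bracket_def
  using quiver_ext_eq [OF assms] quiver_inj by (intro the_equality) (blast, metis)

lemma bracket_permutes:
  assumes "n \<ge> 1" "\<alpha> permutes {1..n}" "j \<le> n"
  shows "bracket n \<alpha> j permutes {1..n+1}"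
  unfolding bracket_eq [OF assms] using assms by (rule quiver_ext_eq)

lemma bracket_inj:
  assumes "n \<ge> 1" "\<alpha> permutes {1..n}" "j \<le> n" "\<alpha>' permutes {1..n}" "j' \<le> n"
    and "bracket n \<alpha> j = bracket n \<alpha>' j'"
  shows "\<alpha> = \<alpha>' \<and> j = j'"
proof -
  have at1: "bracket n \<alpha> j 1 = (if j = 0 then n + 1 else j)"
    if "\<alpha> permutes {1..n}" "j \<le> n" for \<alpha> j
  proof -
    have "\<alpha> (n + 1) = n + 1" using that(1) by (auto simp: permutes_def)
    thus ?thesis using assms(1) that by (simp add: bracket_eq)
  qed
  have j: "j = j'"
    using at1 [OF assms(2,3)] at1 [OF assms(4,5)] assms(3,5,6) by (auto split: if_splits)
  let ?s = "transpose (if j = 0 then n + 1 else j) (n + 1)" and ?t = "transpose 1 (n + 1)"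
  have "?s \<circ> \<alpha> \<circ> ?t = ?s \<circ> \<alpha>' \<circ> ?t"
    using assms(6) bracket_eq [OF assms(1-3)] bracket_eq [OF assms(1,4,5)] by (simp only: j)
  hence "?s \<circ> (?s \<circ> \<alpha> \<circ> ?t) \<circ> ?t = ?s \<circ> (?s \<circ> \<alpha>' \<circ> ?t) \<circ> ?t" by simp
  hence "\<alpha> = \<alpha>'" by (simp add: fun_eq_iff)
  thus ?thesis using j by simp
qed

lemma bracket_surj:
  assumes "n \<ge> 1" "\<beta> permutes {1..n+1}"
  obtains \<alpha> j where "\<alpha> permutes {1..n}" "j \<le> n" "bracket n \<alpha> j = \<beta>"
proof -
  define j where "j = (if \<beta> 1 = n + 1 then 0 else \<beta> 1)"
  let ?s = "transpose (\<beta> 1) (n + 1)" and ?t = "transpose 1 (n + 1)"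
  define \<alpha> where "\<alpha> = ?s \<circ> \<beta> \<circ> ?t"
  have \<beta>1: "\<beta> 1 \<in> {1..n+1}"
    using assms by (subst permutes_in_image) auto
  have s: "transpose (if j = 0 then n + 1 else j) (n + 1) = ?s"
    using \<beta>1 by (auto simp: j_def)
  have "\<alpha> permutes {1..n+1}"
    unfolding \<alpha>_def using \<beta>1 assms
    by (intro permutes_compose permutes_swap_id) auto
  hence \<alpha>: "\<alpha> permutes {1..n}"
  proof (rule permutes_superset)
    fix x assume "x \<in> {1..n+1} - {1..n}"
    hence "x = n + 1" by auto
    thus "\<alpha> x = x" by (simp add: \<alpha>_def)
  qed
  have j: "j \<le> n" using \<beta>1 by (auto simp: j_def)
  have "bracket n \<alpha> j = ?s \<circ> \<alpha> \<circ> ?t"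
    using bracket_eq [OF assms(1) \<alpha> j] by (simp only: s)
  also have "\<dots> = \<beta>" by (simp add: \<alpha>_def fun_eq_iff)
  finally have "bracket n \<alpha> j = \<beta>" .
  thus ?thesis using that \<alpha> j by blast
qed

text \<open>
  The pair \<open>(\<alpha>, j)\<close> selected below is the unique one with \<open>[\<alpha>, j] = \<beta>\<close>
  (\<open>setpart_bracket\<close>); the value for \<open>n = 0\<close> is a dummy.
\<close>

fun setpart :: "nat \<Rightarrow> (nat \<Rightarrow> nat) \<Rightarrow> nat set set" where
  "setpart 0 \<beta> = {}"
| "setpart (Suc 0) \<beta> = {{1}}"
| "setpart (Suc (Suc m)) \<beta> =
     (let n = Suc m;
          (\<alpha>, j) = (THE (\<alpha>, j). \<alpha> permutes {1..n} \<and> j \<le> n \<and> bracket n \<alpha> j = \<beta>)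
      in if j = 0 then setpart n \<alpha> \<union> {{n + 1}}
         else (\<lambda>B. if j \<in> B then B \<union> {n + 1} else B) ` setpart n \<alpha>)"

declare setpart.simps(3) [simp del]

lemma setpart_bracket:
  assumes "n \<ge> 1" "\<alpha> permutes {1..n}" "j \<le> n"
  shows "setpart (n + 1) (bracket n \<alpha> j) =
    (if j = 0 then setpart n \<alpha> \<union> {{n + 1}}
     else (\<lambda>B. if j \<in> B then B \<union> {n + 1} else B) ` setpart n \<alpha>)"
proof -
  obtain m where m: "n = Suc m" using assms(1) by (cases n) auto
  have "(THE (\<alpha>', j'). \<alpha>' permutes {1..n} \<and> j' \<le> n \<and> bracket n \<alpha>' j' = bracket n \<alpha> j) = (\<alpha>, j)"
  proof (rule the_equality)
    fix z
    assume "case z of (\<alpha>', j') \<Rightarrow>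
      \<alpha>' permutes {1..n} \<and> j' \<le> n \<and> bracket n \<alpha>' j' = bracket n \<alpha> j"
    thus "z = (\<alpha>, j)"
      using bracket_inj [OF assms(1) _ _ assms(2,3)] by (cases z) blast
  qed (use assms in simp)
  thus ?thesis using setpart.simps(3) [of m "bracket n \<alpha> j"] m by (simp add: Let_def)
qed

lemma setpart_finite_Union:
  assumes "n \<ge> 1" "\<alpha> permutes {1..n}"
  shows "finite (setpart n \<alpha>) \<and> \<Union> (setpart n \<alpha>) = {1..n}"
  using assms
proof (induction n arbitrary: \<alpha> rule: nat_induct_at_least)
  case (Suc n)
  have "\<alpha> permutes {1..n+1}" using Suc.prems by simp
  then obtain \<alpha>' j where \<alpha>': "\<alpha>' permutes {1..n}" "j \<le> n" "bracket n \<alpha>' j = \<alpha>"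
    using bracket_surj Suc.hyps by blast
  have IH: "finite (setpart n \<alpha>')" "\<Union> (setpart n \<alpha>') = {1..n}"
    using Suc.IH \<alpha>'(1) by blast+
  have eq: "setpart (Suc n) \<alpha> =
    (if j = 0 then setpart n \<alpha>' \<union> {{n + 1}}
     else (\<lambda>B. if j \<in> B then B \<union> {n + 1} else B) ` setpart n \<alpha>')"
    using setpart_bracket [OF Suc.hyps \<alpha>'(1,2)] \<alpha>'(3) by simp
  show ?case
  proof (cases "j = 0")
    case True
    thus ?thesis using IH eq by (auto simp: atLeastAtMostSuc_conv)
  next
    case False
    hence "j \<in> \<Union> (setpart n \<alpha>')" using IH \<alpha>'(2) by auto
    then obtain B where "B \<in> setpart n \<alpha>'" "j \<in> B" by blast
    hence "\<Union> ((\<lambda>B. if j \<in> B then B \<union> {n + 1} else B) ` setpart n \<alpha>') =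
        \<Union> (setpart n \<alpha>') \<union> {n + 1}"
      by (auto split: if_splits)
    moreover have "{1..Suc n} = {1..n} \<union> {n + 1}" by auto
    ultimately show ?thesis using False IH by (simp only: eq if_False finite_imageI)
  qed
qed simp


section \<open>The summations \<open>FS\<^sub>\<alpha>\<close>\<close>

definition cycle_supports :: "nat \<Rightarrow> (nat \<Rightarrow> nat) \<Rightarrow> nat set set" where
  "cycle_supports n \<alpha> = orbit \<alpha> ` {1..n}"

text \<open>
  The operator \<open>\<Prod>\<^sub>B k\<^sub>B \<partial>/\<partial>p\<^bsub>k\<^sub>B\<^esub>\<close> is a product of commuting operators
  (\<open>comp_fun_commute_kderiv\<close> below).
\<close>

definition kderiv :: "(nat \<Rightarrow> nat) \<Rightarrow> nat set \<Rightarrow> ppoly \<Rightarrow> ppoly" where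
  "kderiv k B F = of_nat (\<Sum>t\<in>B. k t) * pdiff (\<Sum>t\<in>B. k t) F"

lemma lookup_pdiff:
  "Poly_Mapping.lookup (pdiff k F) l = of_nat (count l k + 1) * Poly_Mapping.lookup F (add_mset k l)"
  by transfer simp

lemma lookup_of_nat_times:
  "Poly_Mapping.lookup (of_nat c * (F :: ppoly)) l = of_nat c * Poly_Mapping.lookup F l"
  by (induction c) (simp_all add: lookup_add algebra_simps)

lemma comp_fun_commute_kderiv: "comp_fun_commute (kderiv k)"
proof
  fix A B
  show "kderiv k B \<circ> kderiv k A = kderiv k A \<circ> kderiv k B"
    by (auto simp: fun_eq_iff kderiv_def lookup_pdiff lookup_of_nat_times add_mset_commute
        simp del: of_nat_sum intro!: poly_mapping_eqI)
qed

definition FS_term :: "nat \<Rightarrow> (nat \<Rightarrow> nat) \<Rightarrow> (nat \<Rightarrow> nat) \<Rightarrow> ppoly \<Rightarrow> ppoly" where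
  "FS_term n \<alpha> k F =
     (\<Prod>c\<in>cycle_supports n \<alpha>. pvar (\<Sum>t\<in>c. k t)) * Finite_Set.fold (kderiv k) F (setpart n \<alpha>)"

lemma kderiv_nonzero:
  assumes "kderiv k B G \<noteq> 0"
  shows "(\<Sum>t\<in>B. k t) \<in> \<Union> (set_mset ` Poly_Mapping.keys G)"
proof -
  have "\<exists>l. Poly_Mapping.lookup (kderiv k B G) l \<noteq> 0"
    using assms by (metis poly_mapping_eqI lookup_zero)
  then obtain l where "Poly_Mapping.lookup G (add_mset (\<Sum>t\<in>B. k t) l) \<noteq> 0"
    by (auto simp: kderiv_def lookup_pdiff lookup_of_nat_times simp del: of_nat_sum)
  hence "add_mset (\<Sum>t\<in>B. k t) l \<in> Poly_Mapping.keys G" by (simp add: in_keys_iff)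
  thus ?thesis by (rule UN_I) simp
qed

lemma kderiv_vars:
  "\<Union> (set_mset ` Poly_Mapping.keys (kderiv k B G)) \<subseteq> \<Union> (set_mset ` Poly_Mapping.keys G)"
proof
  fix v assume "v \<in> \<Union> (set_mset ` Poly_Mapping.keys (kderiv k B G))"
  then obtain l where "v \<in># l" "Poly_Mapping.lookup G (add_mset (\<Sum>t\<in>B. k t) l) \<noteq> 0"
    by (auto simp: in_keys_iff kderiv_def lookup_pdiff lookup_of_nat_times simp del: of_nat_sum)
  hence "add_mset (\<Sum>t\<in>B. k t) l \<in> Poly_Mapping.keys G" "v \<in># add_mset (\<Sum>t\<in>B. k t) l"
    by (simp_all add: in_keys_iff)
  thus "v \<in> \<Union> (set_mset ` Poly_Mapping.keys G)" by (rule UN_I)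
qed

lemma fold_kderiv_nonzero:
  assumes "finite P" "Finite_Set.fold (kderiv k) F P \<noteq> 0" "B \<in> P"
  shows "(\<Sum>t\<in>B. k t) \<in> \<Union> (set_mset ` Poly_Mapping.keys F)"
proof -
  interpret comp_fun_commute "kderiv k" by (rule comp_fun_commute_kderiv)
  have vars: "\<Union> (set_mset ` Poly_Mapping.keys (Finite_Set.fold (kderiv k) F P))
      \<subseteq> \<Union> (set_mset ` Poly_Mapping.keys F)" if "finite P" for P
    using that
  proof (induction P rule: finite_induct)
    case (insert C P)
    thus ?case using kderiv_vars [of k C "Finite_Set.fold (kderiv k) F P"] by simp
  qed simp
  have "Finite_Set.fold (kderiv k) F P =
      kderiv k B (Finite_Set.fold (kderiv k) F (P - {B}))"
    using assms by (intro fold_rec)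
  hence "kderiv k B (Finite_Set.fold (kderiv k) F (P - {B})) \<noteq> 0"
    using assms(2) by simp
  thus ?thesis using kderiv_nonzero vars assms(1) by (meson finite_Diff subsetD)
qed

lemma finite_FS_terms:
  assumes "n \<ge> 1" "\<alpha> permutes {1..n}"
  shows "finite {k \<in> {1..n} \<rightarrow>\<^sub>E {1..}. FS_term n \<alpha> k F \<noteq> 0}"
proof -
  let ?V = "\<Union> (set_mset ` Poly_Mapping.keys F)"
  have V: "finite ?V" by simp
  show ?thesis
  proof (rule finite_PiE_bounded)
    fix k t assume kt: "FS_term n \<alpha> k F \<noteq> 0" "t \<in> {1..n}"
    obtain B where B: "B \<in> setpart n \<alpha>" "t \<in> B"
      using setpart_finite_Union [OF assms] kt(2) by blast
    have "finite B"
      using setpart_finite_Union [OF assms] B(1) by (metis Union_upper finite_atLeastAtMost finite_subset)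
    hence "k t \<le> (\<Sum>t\<in>B. k t)" using B(2) by (intro member_le_sum) auto
    moreover have "(\<Sum>t\<in>B. k t) \<in> ?V"
      using kt(1) setpart_finite_Union [OF assms] B(1)
      by (intro fold_kderiv_nonzero [where P = "setpart n \<alpha>"]) (auto simp: FS_term_def)
    hence "(\<Sum>t\<in>B. k t) \<le> Max ?V" by (rule Max_ge [OF V])
    ultimately show "k t \<in> {..Max ?V}" by simp
  qed simp_all
qed

text \<open>
  Applied to a polynomial only finitely many terms of the sum over \<open>k\<^sub>1, \<dots>, k\<^sub>n \<ge> 1\<close> are
  nonzero (\<open>finite_FS_terms\<close>), so that the result is again a polynomial.
\<close>

definition FS :: "nat \<Rightarrow> (nat \<Rightarrow> nat) \<Rightarrow> ppoly \<Rightarrow> ppoly" where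
  "FS n \<alpha> F = Poly_Mapping.single {#} (1 / of_nat n) *
     (\<Sum>k \<in> {k \<in> {1..n} \<rightarrow>\<^sub>E {1..}. FS_term n \<alpha> k F \<noteq> 0}. FS_term n \<alpha> k F)"

end

theory Submission
  imports Defs
begin

text \<open>
  Every coefficient of a power series involves only finitely many rows and columns of the matrix
  \<open>X\<close>. In \<open>W([n]) f\<close> each index \<open>a\<^sub>i\<close>, \<open>e\<^sub>i\<close> of a derivative also occurs in one of the factors \<open>X\<close>
  on the left, so that setting all entries outside an \<open>N \<times> N\<close> corner to zero commutes with
  \<open>W([n])\<close>. It therefore suffices to compare both sides after this truncation (\<open>mfps_eqI_trunc\<close>,
  \<open>trunc_Wop\<close>), where all sums over indices are finite and \<open>p\<^sub>k\<close> is the trace of \<open>X\<^sup>k\<close>.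

  The heart of the matter is a closed formula for
  \<open>\<partial>/\<partial>X(a\<^sub>n, e\<^sub>n) \<dots> \<partial>/\<partial>X(a\<^sub>1, e\<^sub>1) F\<close>, for fixed indices and before anything is multiplied by the
  factors \<open>X\<close> (\<open>fold_mderiv_peval\<close>). Two rules suffice:
  a derivative by the entry \<open>(b, d)\<close> turns \<open>p\<^sub>k\<close> into \<open>k (X\<^bsup>k-1\<^esup>)(d, b)\<close>, and it cuts a power:
  \<open>(X\<^bsup>k-1\<^esup>)(u, v)\<close> becomes the sum of \<open>(X\<^bsup>i-1\<^esup>)(u, b) (X\<^bsup>j-1\<^esup>)(d, v)\<close> over \<open>i + j = k\<close> with \<open>i, j \<ge> 1\<close>.
  Read \<open>X\<^bsup>k-1\<^esup>\<close> as an arrow of weight \<open>k\<close>. The first rule, applied to the polynomial, adds an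
  arrow to the quiver and a new singleton block to the set partition, which is the passage from
  \<open>\<alpha>\<close> to \<open>[\<alpha>, 0]\<close>. The second one cuts the arrow with target \<open>j\<close> in two whose weights add up to the old
  one, so that the weight of the block of \<open>j\<close> is unchanged when the new vertex joins it; this is
  the passage to \<open>[\<alpha>, j]\<close>. As every element of \<open>S\<^bsub>n+1\<^esub>\<close> is \<open>[\<alpha>, j]\<close> for exactly one pair, induction
  on \<open>n\<close> produces one summation for each permutation (\<open>mderiv_sum_quiver_term\<close>). Working with the
  exponents \<open>k - 1\<close> keeps the normal ordering out of the computation: no derivative ever meets one
  of the factors \<open>X\<close> on the left.

  Finally the sum over \<open>e\<^sub>i\<close> restores the missing factor \<open>X\<close> of each arrow, and the sum over the
  \<open>a\<^sub>i\<close> composes the powers along each cycle of \<open>\<alpha>\<close> and takes a trace (\<open>sum_prod_matpow\<close>,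
  \<open>sum_contract_quiver_term\<close>). The result is \<open>FS\<^sub>\<alpha>\<close>, which is again a polynomial.
\<close>


section \<open>Formal partial derivatives\<close>

lemma coef_zero [simp]: "coef 0 m = 0"
  by (simp add: zero_mfps_def)

lemma coef_plus [simp]: "coef (f + g) m = coef f m + coef g m"
  by (simp add: plus_mfps_def)

lemma coef_one: "coef 1 m = (if m = {#} then 1 else 0)"
  by (simp add: one_mfps_def)

lemma coef_sum: "coef (\<Sum>i\<in>A. f i) m = (\<Sum>i\<in>A. coef (f i) m)"
  by (induction A rule: infinite_finite_induct) auto

lemma coef_mconst_times: "coef (mconst c * f) m = c * coef f m"
proof -
  have "coef (mconst c * f) m = (\<Sum>x\<in>splits m. if x = ({#}, m) then c * coef f m else 0)"
    unfolding coef_times mconst_def coef_Mfps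
    by (rule sum.cong) (auto simp: splits_def split: if_splits)
  also have "\<dots> = c * coef f m"
    using finite_splits [of m] by (subst sum.delta) (simp_all, simp add: splits_def)
  finally show ?thesis .
qed

lemma mconst_0: "mconst 0 = 0"
  by (rule mfps_eqI) (simp add: mconst_def)

lemma mconst_1: "mconst 1 = 1"
  by (rule mfps_eqI) (simp add: mconst_def coef_one)

lemma mconst_add: "mconst (c + d) = mconst c + mconst d"
  by (rule mfps_eqI) (simp add: mconst_def)

lemma mconst_mult: "mconst (c * d) = mconst c * mconst d"
  by (rule mfps_eqI) (simp add: coef_mconst_times, simp add: mconst_def)

lemma mconst_of_nat: "mconst (of_nat c) = of_nat c"
  by (induction c) (simp_all add: mconst_0 mconst_1 mconst_add)

lemma mderiv_add: "mderiv v (f + g) = mderiv v f + mderiv v g"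
  by (rule mfps_eqI) (simp add: mderiv_def algebra_simps)

lemma mderiv_0: "mderiv v 0 = 0"
  by (rule mfps_eqI) (simp add: mderiv_def)

lemma mderiv_sum: "mderiv v (\<Sum>i\<in>A. f i) = (\<Sum>i\<in>A. mderiv v (f i))"
  by (induction A rule: infinite_finite_induct) (auto simp: mderiv_add mderiv_0)

lemma mderiv_mconst: "mderiv v (mconst c) = 0"
  by (rule mfps_eqI) (simp add: mderiv_def mconst_def)

lemma mderiv_1: "mderiv v 1 = 0"
  using mderiv_mconst [of v 1] by (simp add: mconst_1)

lemma mderiv_mvar: "mderiv v (mvar w) = (if v = w then 1 else 0)"
  by (rule mfps_eqI) (auto simp: mderiv_def mvar_def coef_one)

text \<open>
  If \<open>a + b = m + v\<close>, then the factor \<open>count m v + 1\<close> in the definition of the derivative is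
  \<open>count a v + count b v\<close>; the two summands account for the two terms of the product rule.
\<close>

lemma mderiv_mult: "mderiv v (f * g) = mderiv v f * g + f * mderiv v g"
proof (rule mfps_eqI)
  fix m
  have half: "(\<Sum>(a, b)\<in>splits (add_mset v m). of_nat (count a v) * (coef f a * coef g b)) =
      coef (mderiv v f * g) m" for f g :: "'a mfps"
  proof -
    have "coef (mderiv v f * g) m =
        (\<Sum>(a, b)\<in>(\<lambda>(a, b). (add_mset v a, b)) ` splits m.
           of_nat (count a v) * (coef f a * coef g b))"
      unfolding coef_times
      by (subst sum.reindex) (auto simp: inj_on_def mderiv_def case_prod_unfold algebra_simps)
    also have "\<dots> =
        (\<Sum>(a, b)\<in>splits (add_mset v m). of_nat (count a v) * (coef f a * coef g b))"
    proof (rule sum.mono_neutral_left)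
      show "\<forall>i\<in>splits (add_mset v m) - (\<lambda>(a, b). (add_mset v a, b)) ` splits m.
          (case i of (a, b) \<Rightarrow> of_nat (count a v) * (coef f a * coef g b)) = 0"
      proof (clarify, rule ccontr)
        fix a b
        assume ab: "(a, b) \<in> splits (add_mset v m)"
          "(a, b) \<notin> (\<lambda>(a, b). (add_mset v a, b)) ` splits m"
          "of_nat (count a v) * (coef f a * coef g b) \<noteq> 0"
        have "v \<in># a" using ab(3) by (auto simp flip: count_greater_zero_iff)
        then obtain a' where "a = add_mset v a'" by (metis multi_member_split)
        with ab(1) have "(a', b) \<in> splits m" and "(a, b) = (\<lambda>(a, b). (add_mset v a, b)) (a', b)"
          by (auto simp: splits_def)
        thus False using ab(2) by blast
      qed
      show "(\<lambda>(a, b). (add_mset v a, b)) ` splits m \<subseteq> splits (add_mset v m)"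
        by (auto simp: splits_def)
    qed simp
    finally show ?thesis by simp
  qed
  have "coef (mderiv v (f * g)) m =
      (\<Sum>(a, b)\<in>splits (add_mset v m). of_nat (count m v + 1) * (coef f a * coef g b))"
    by (simp add: mderiv_def coef_times sum_distrib_left case_prod_unfold)
  also have "\<dots> = (\<Sum>(a, b)\<in>splits (add_mset v m).
      of_nat (count a v) * (coef f a * coef g b) + of_nat (count b v) * (coef f a * coef g b))"
  proof (rule sum.cong, rule refl, clarify)
    fix a b assume "(a, b) \<in> splits (add_mset v m)"
    hence "count (a + b) v = count m v + 1" by (simp add: splits_def)
    hence "count m v + 1 = count a v + count b v" by simp
    thus "of_nat (count m v + 1) * (coef f a * coef g b) =
        of_nat (count a v) * (coef f a * coef g b) + of_nat (count b v) * (coef f a * coef g b)"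
      by (simp only: of_nat_add distrib_right)
  qed
  also have "\<dots> = coef (mderiv v f * g) m +
      (\<Sum>(a, b)\<in>splits (add_mset v m). of_nat (count b v) * (coef f a * coef g b))"
    unfolding half [symmetric] by (simp add: case_prod_unfold sum.distrib)
  also have "(\<Sum>(a, b)\<in>splits (add_mset v m). of_nat (count b v) * (coef f a * coef g b)) =
      (\<Sum>(a, b)\<in>splits (add_mset v m). of_nat (count a v) * (coef g a * coef f b))"
    by (rule sum.reindex_bij_witness [where i = prod.swap and j = prod.swap])
       (auto simp: splits_def algebra_simps)
  also have "\<dots> = coef (f * mderiv v g) m" unfolding half by (simp add: mult.commute)
  finally show "coef (mderiv v (f * g)) m = coef (mderiv v f * g + f * mderiv v g) m" by simp
qed

lemma mderiv_prod:
  assumes "finite A"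
  shows "mderiv v (\<Prod>i\<in>A. f i) = (\<Sum>i\<in>A. mderiv v (f i) * (\<Prod>t\<in>A - {i}. f t))"
  using assms
proof (induction A rule: finite_induct)
  case (insert x A)
  have "(\<Prod>t\<in>insert x A - {i}. f t) = f x * (\<Prod>t\<in>A - {i}. f t)" if "i \<in> A" for i
  proof -
    have "insert x A - {i} = insert x (A - {i})" using that insert.hyps by auto
    thus ?thesis using insert.hyps by simp
  qed
  thus ?case using insert
    by (simp add: mderiv_mult sum_distrib_left algebra_simps)
qed (simp add: mderiv_1)


section \<open>Polynomials evaluated at power series\<close>

text \<open>
  The map \<^term>\<open>ev\<close>, with arbitrary power series in place of the traces: the truncated traces below
  are evaluated in the same way.
\<close>

definition peval :: "(nat \<Rightarrow> 'v mfps) \<Rightarrow> ppoly \<Rightarrow> 'v mfps" where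
  "peval p F = (\<Sum>l\<in>Poly_Mapping.keys F. mconst (Poly_Mapping.lookup F l) * (\<Prod>k\<in>#l. p k))"

lemma ev_eq_peval: "ev F = peval psum F"
  by (simp add: ev_def peval_def)

lemma peval_superset:
  assumes "finite S" "Poly_Mapping.keys F \<subseteq> S"
  shows "peval p F = (\<Sum>l\<in>S. mconst (Poly_Mapping.lookup F l) * (\<Prod>k\<in>#l. p k))"
  unfolding peval_def
  by (rule sum.mono_neutral_left) (use assms in \<open>auto simp: in_keys_iff mconst_0\<close>)

lemma peval_0: "peval p 0 = 0"
  by (simp add: peval_def)

lemma peval_add: "peval p (F + G) = peval p F + peval p G"
proof -
  let ?S = "Poly_Mapping.keys F \<union> Poly_Mapping.keys G"
  have "peval p (F + G) =
      (\<Sum>l\<in>?S. mconst (Poly_Mapping.lookup (F + G) l) * (\<Prod>k\<in>#l. p k))"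
    by (rule peval_superset) (use Poly_Mapping.keys_add [of F G] in auto)
  also have "\<dots> = peval p F + peval p G"
    by (simp add: peval_superset [of ?S F] peval_superset [of ?S G] lookup_add mconst_add
        distrib_right sum.distrib)
  finally show ?thesis .
qed

lemma peval_sum: "peval p (\<Sum>i\<in>A. F i) = (\<Sum>i\<in>A. peval p (F i))"
  by (induction A rule: infinite_finite_induct) (auto simp: peval_add peval_0)

lemma peval_single: "peval p (Poly_Mapping.single l c) = mconst c * (\<Prod>k\<in>#l. p k)"
  by (subst peval_superset [where S = "{l}"]) (auto simp: mconst_0)

lemma sum_single_lookup:
  fixes G :: "'a \<Rightarrow>\<^sub>0 'b::comm_monoid_add"
  shows "(\<Sum>l\<in>Poly_Mapping.keys G. Poly_Mapping.single l (Poly_Mapping.lookup G l)) = G"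
  by (rule poly_mapping_eqI)
     (auto simp: lookup_sum lookup_single when_def in_keys_iff)

lemma peval_single_times:
  "peval p (Poly_Mapping.single l c * G) = mconst c * (\<Prod>k\<in>#l. p k) * peval p G"
proof -
  have "peval p (Poly_Mapping.single l c * G) =
      peval p (\<Sum>l'\<in>Poly_Mapping.keys G.
        Poly_Mapping.single l c * Poly_Mapping.single l' (Poly_Mapping.lookup G l'))"
    by (simp add: sum_single_lookup flip: sum_distrib_left)
  also have "\<dots> = mconst c * (\<Prod>k\<in>#l. p k) * peval p G"
    by (simp add: peval_sum mult_single peval_single mconst_mult peval_def [of p G]
        sum_distrib_left algebra_simps)
  finally show ?thesis .
qed

lemma peval_of_nat_times: "peval p (of_nat c * G) = of_nat c * peval p G"
  by (induction c) (simp_all add: peval_0 peval_add distrib_right)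

lemma peval_prod_pvar_times:
  "peval p ((\<Prod>c\<in>A. pvar (h c)) * G) = (\<Prod>c\<in>A. p (h c)) * peval p G"
proof (induction A arbitrary: G rule: infinite_finite_induct)
  case (insert x A)
  have "peval p ((\<Prod>c\<in>insert x A. pvar (h c)) * G) =
      peval p ((\<Prod>c\<in>A. pvar (h c)) * (pvar (h x) * G))"
    using insert.hyps by (simp add: ac_simps)
  also have "\<dots> = (\<Prod>c\<in>A. p (h c)) * peval p (pvar (h x) * G)" by (rule insert.IH)
  also have "peval p (pvar (h x) * G) = p (h x) * peval p G"
    unfolding pvar_def peval_single_times by (simp add: mconst_1)
  finally show ?case using insert.hyps by (simp add: ac_simps)
qed auto

lemma mderiv_prod_mset:
  assumes "finite S" "set_mset l \<subseteq> S"
  shows "mderiv v (\<Prod>k\<in>#l. p k) =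
    (\<Sum>c\<in>S. of_nat (count l c) * mderiv v (p c) * (\<Prod>k\<in>#(l - {#c#}). p k))"
  using assms(2)
proof (induction l)
  case (add x l)
  have x: "x \<in> S" using add.prems by simp
  have "mderiv v (\<Prod>k\<in>#add_mset x l. p k) = mderiv v (p x) * (\<Prod>k\<in>#l. p k) +
      (\<Sum>c\<in>S. p x * (of_nat (count l c) * mderiv v (p c) * (\<Prod>k\<in>#(l - {#c#}). p k)))"
    using add by (simp add: mderiv_mult sum_distrib_left)
  also have "mderiv v (p x) * (\<Prod>k\<in>#l. p k) =
      (\<Sum>c\<in>S. if c = x then mderiv v (p x) * (\<Prod>k\<in>#l. p k) else 0)"
    using assms(1) x by simp
  also have "\<dots> +
      (\<Sum>c\<in>S. p x * (of_nat (count l c) * mderiv v (p c) * (\<Prod>k\<in>#(l - {#c#}). p k))) =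
      (\<Sum>c\<in>S. of_nat (count (add_mset x l) c) * mderiv v (p c) *
        (\<Prod>k\<in>#(add_mset x l - {#c#}). p k))"
    unfolding sum.distrib [symmetric]
  proof (rule sum.cong [OF refl])
    fix c
    have split: "p x * (\<Prod>k\<in>#(l - {#c#}). p k) = (\<Prod>k\<in>#(add_mset x l - {#c#}). p k)"
      if "c \<in># l"
    proof -
      have "add_mset x l - {#c#} = add_mset x (l - {#c#})"
        using that by (simp add: add_mset_diff_bothsides)
      thus ?thesis by simp
    qed
    show "(if c = x then mderiv v (p x) * (\<Prod>k\<in>#l. p k) else 0) +
        p x * (of_nat (count l c) * mderiv v (p c) * (\<Prod>k\<in>#(l - {#c#}). p k)) =
        of_nat (count (add_mset x l) c) * mderiv v (p c) *
          (\<Prod>k\<in>#(add_mset x l - {#c#}). p k)"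
    proof (cases "c \<in># l")
      case True
      hence "p x * (of_nat (count l c) * mderiv v (p c) * (\<Prod>k\<in>#(l - {#c#}). p k)) =
          of_nat (count l c) * mderiv v (p c) * (\<Prod>k\<in>#(add_mset x l - {#c#}). p k)"
        using split by (metis (no_types, lifting) mult.left_commute)
      thus ?thesis by (auto simp: distrib_right)
    qed (auto simp: not_in_iff)
  qed
  finally show ?case .
qed (simp add: mderiv_1)

text \<open>
  The chain rule: the coefficient of a monomial \<open>l\<close> contributes to the derivative with
  respect to the \<open>c\<close>-th indeterminate at the monomial \<open>l - {#c#}\<close>.
\<close>

lemma mderiv_peval:
  assumes "finite S" "\<Union> (set_mset ` Poly_Mapping.keys F) \<subseteq> S"
  shows "mderiv v (peval p F) = (\<Sum>c\<in>S. mderiv v (p c) * peval p (pdiff c F))"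
proof -
  let ?K = "Poly_Mapping.keys F" and ?F = "Poly_Mapping.lookup F"
  have "mderiv v (peval p F) =
      (\<Sum>l\<in>?K. mconst (?F l) *
        (\<Sum>c\<in>S. of_nat (count l c) * mderiv v (p c) * (\<Prod>k\<in>#(l - {#c#}). p k)))"
    unfolding peval_def mderiv_sum
  proof (rule sum.cong [OF refl])
    fix l assume "l \<in> ?K"
    hence "set_mset l \<subseteq> S" using assms(2) by auto
    thus "mderiv v (mconst (?F l) * (\<Prod>k\<in>#l. p k)) = mconst (?F l) *
        (\<Sum>c\<in>S. of_nat (count l c) * mderiv v (p c) * (\<Prod>k\<in>#(l - {#c#}). p k))"
      by (simp add: mderiv_mult mderiv_mconst mderiv_prod_mset [OF assms(1)])
  qed
  also have "\<dots> = (\<Sum>c\<in>S. mderiv v (p c) *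
      (\<Sum>l\<in>?K. mconst (of_nat (count l c) * ?F l) * (\<Prod>k\<in>#(l - {#c#}). p k)))"
    by (simp add: sum_distrib_left mconst_mult mconst_of_nat ac_simps) (rule sum.swap)
  also have "\<dots> = (\<Sum>c\<in>S. mderiv v (p c) * peval p (pdiff c F))"
  proof (rule sum.cong [OF refl])
    fix c
    have "peval p (pdiff c F) =
        (\<Sum>l\<in>{l\<in>?K. c \<in># l}. mconst (of_nat (count l c) * ?F l) * (\<Prod>k\<in>#(l - {#c#}). p k))"
      unfolding peval_def
      by (rule sum.reindex_bij_witness [where i = "\<lambda>l. l - {#c#}" and j = "add_mset c"])
         (auto simp: in_keys_iff lookup_pdiff simp del: of_nat_add of_nat_Suc)
    also have "\<dots> =
        (\<Sum>l\<in>?K. mconst (of_nat (count l c) * ?F l) * (\<Prod>k\<in>#(l - {#c#}). p k))"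
      by (rule sum.mono_neutral_left) (auto simp: not_in_iff mconst_0)
    finally show "mderiv v (p c) *
        (\<Sum>l\<in>?K. mconst (of_nat (count l c) * ?F l) * (\<Prod>k\<in>#(l - {#c#}). p k)) =
        mderiv v (p c) * peval p (pdiff c F)" by simp
  qed
  finally show ?thesis .
qed


section \<open>Truncation to finite matrices\<close>

text \<open>
  A coefficient of a power series involves only finitely many rows and columns. Setting to zero
  all variables outside the first \<open>N\<close> rows and columns therefore loses nothing if it is done for
  every \<open>N\<close> (\<open>mfps_eqI_trunc\<close> below), and it turns all sums over indices into finite ones.
\<close>

definition trunc :: "nat \<Rightarrow> xseries \<Rightarrow> xseries" where
  "trunc N f = Mfps (\<lambda>m. if set_mset m \<subseteq> {..<N} \<times> {..<N} then coef f m else 0)"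

lemma mfps_eqI_trunc:
  assumes "\<And>N. trunc N f = trunc N g"
  shows "f = g"
proof (rule mfps_eqI)
  fix m :: "(nat \<times> nat) multiset"
  define N where "N = Suc (Max (fst ` set_mset m \<union> snd ` set_mset m))"
  have "set_mset m \<subseteq> {..<N} \<times> {..<N}"
    unfolding N_def by (force simp: less_Suc_eq_le intro!: Max_ge)
  thus "coef f m = coef g m"
    using arg_cong [OF assms [of N], of "\<lambda>h. coef h m"] by (simp add: trunc_def)
qed

lemma trunc_0: "trunc N 0 = 0"
  by (rule mfps_eqI) (simp add: trunc_def)

lemma trunc_1: "trunc N 1 = 1"
  by (rule mfps_eqI) (simp add: trunc_def coef_one)

lemma trunc_mconst: "trunc N (mconst c) = mconst c"
  by (rule mfps_eqI) (simp add: trunc_def mconst_def)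

lemma trunc_add: "trunc N (f + g) = trunc N f + trunc N g"
  by (rule mfps_eqI) (simp add: trunc_def)

lemma trunc_sum: "trunc N (\<Sum>i\<in>A. f i) = (\<Sum>i\<in>A. trunc N (f i))"
  by (induction A rule: infinite_finite_induct) (auto simp: trunc_add trunc_0)

lemma trunc_mult: "trunc N (f * g) = trunc N f * trunc N g"
proof (rule mfps_eqI)
  fix m
  show "coef (trunc N (f * g)) m = coef (trunc N f * trunc N g) m"
  proof (cases "set_mset m \<subseteq> {..<N} \<times> {..<N}")
    case True
    hence "coef (trunc N (f * g)) m = (\<Sum>(a, b)\<in>splits m. coef f a * coef g b)"
      by (simp add: trunc_def coef_times)
    also have "\<dots> = (\<Sum>(a, b)\<in>splits m. coef (trunc N f) a * coef (trunc N g) b)"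
      using True by (intro sum.cong) (auto simp: splits_def trunc_def)
    finally show ?thesis by (simp add: coef_times)
  next
    case False
    have "(\<Sum>(a, b)\<in>splits m. coef (trunc N f) a * coef (trunc N g) b) = 0"
      by (intro sum.neutral) (use False in \<open>auto simp: splits_def trunc_def\<close>)
    thus ?thesis using False by (simp add: trunc_def coef_times)
  qed
qed

lemma trunc_prod: "trunc N (\<Prod>i\<in>A. f i) = (\<Prod>i\<in>A. trunc N (f i))"
  by (induction A rule: infinite_finite_induct) (auto simp: trunc_mult trunc_1)

lemma trunc_prod_mset: "trunc N (\<Prod>i\<in>#A. f i) = (\<Prod>i\<in>#A. trunc N (f i))"
  by (induction A) (auto simp: trunc_mult trunc_1)

lemma trunc_mvar: "trunc N (mvar (a, b)) = (if a < N \<and> b < N then mvar (a, b) else 0)"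
  by (rule mfps_eqI) (auto simp: trunc_def mvar_def)

lemma trunc_prod_mvar_0:
  assumes "finite A" "i \<in> A" "\<not> (a i < N \<and> b i < N)"
  shows "trunc N (\<Prod>i\<in>A. mvar (a i, b i)) = 0"
  unfolding trunc_prod by (rule prod_zero) (use assms in \<open>auto simp: trunc_mvar\<close>)

lemma trunc_mderiv:
  assumes "a < N" "b < N"
  shows "trunc N (mderiv (a, b) f) = mderiv (a, b) (trunc N f)"
  by (rule mfps_eqI) (use assms in \<open>auto simp: trunc_def mderiv_def\<close>)

lemma trunc_peval: "trunc N (peval p F) = peval (\<lambda>k. trunc N (p k)) F"
  by (simp add: peval_def trunc_sum trunc_mult trunc_mconst trunc_prod_mset)

lemma trunc_fsum:
  assumes "finite B" "B \<subseteq> A" "\<And>i. i \<in> A - B \<Longrightarrow> trunc N (g i) = 0"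
  shows "trunc N (fsum A g) = (\<Sum>i\<in>B. trunc N (g i))"
proof (rule mfps_eqI)
  fix m
  show "coef (trunc N (fsum A g)) m = coef (\<Sum>i\<in>B. trunc N (g i)) m"
  proof (cases "set_mset m \<subseteq> {..<N} \<times> {..<N}")
    case True
    have "coef (g i) m = 0" if "i \<in> A - B" for i
      using arg_cong [OF assms(3) [OF that], of "\<lambda>h. coef h m"] True by (simp add: trunc_def)
    hence "(\<Sum>i \<in> {i \<in> A. coef (g i) m \<noteq> 0}. coef (g i) m) = (\<Sum>i\<in>B. coef (g i) m)"
      using assms(1,2) by (intro sum.mono_neutral_left) auto
    thus ?thesis using True by (simp add: trunc_def fsum_def coef_sum)
  next
    case False
    thus ?thesis by (auto simp: trunc_def coef_sum)
  qed
qed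

lemma sum_PiE_insert:
  assumes "x \<notin> S"
  shows "(\<Sum>a\<in>insert x S \<rightarrow>\<^sub>E T. h a) = (\<Sum>a\<in>S \<rightarrow>\<^sub>E T. \<Sum>c\<in>T. h (a(x := c)))"
proof -
  have "(\<Sum>a\<in>insert x S \<rightarrow>\<^sub>E T. h a) = (\<Sum>(c, a)\<in>T \<times> (S \<rightarrow>\<^sub>E T). h (a(x := c)))"
    unfolding PiE_insert_eq using assms inj_combinator [of x S "\<lambda>_. T"]
    by (subst sum.reindex) (auto simp: case_prod_unfold)
  also have "\<dots> = (\<Sum>c\<in>T. \<Sum>a\<in>S \<rightarrow>\<^sub>E T. h (a(x := c)))"
    by (rule sum.cartesian_product [symmetric])
  finally show ?thesis by (subst (asm) sum.swap)
qed

lemma cyc_bij: "bij_betw (cyc n) {1..n} {1..n}"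
proof -
  have "cyc n ` {1..n} = {1..n}"
  proof
    show "cyc n ` {1..n} \<subseteq> {1..n}" by (auto simp: cyc_def)
    show "{1..n} \<subseteq> cyc n ` {1..n}" using cyc_surj by blast
  qed
  thus ?thesis by (simp add: bij_betw_def eq_card_imp_inj_on)
qed

text \<open>
  Each \<open>a\<^sub>i\<close> and each \<open>e\<^sub>i\<close> is an index of one of the factors \<open>X\<close>. A summand that survives truncation
  thus has all its indices below \<open>N\<close>, and then its derivatives are by entries of the corner, which
  commute with truncation.
\<close>

lemma trunc_Wop:
  "trunc N (Wop n f) = mconst (1 / of_nat n) *
     (\<Sum>a\<in>{1..n} \<rightarrow>\<^sub>E {..<N}. \<Sum>e\<in>{1..n} \<rightarrow>\<^sub>E {..<N}.
        (\<Prod>i\<in>{1..n}. mvar (a (cyc n i), e i)) *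
        fold (\<lambda>i. mderiv (a i, e i)) [1..<n+1] (trunc N f))"
proof -
  let ?T = "\<lambda>a e. (\<Prod>i\<in>{1..n}. mvar (a (cyc n i), e i)) *
    fold (\<lambda>i. mderiv (a i, e i)) [1..<n+1] f"
  have fold: "trunc N (fold (\<lambda>i. mderiv (a i, e i)) xs f) =
      fold (\<lambda>i. mderiv (a i, e i)) xs (trunc N f)"
    if "\<forall>i\<in>set xs. a i < N \<and> e i < N" for a e :: "nat \<Rightarrow> nat" and xs
    using that by (induction xs arbitrary: f) (auto simp: trunc_mderiv)
  have zero: "trunc N (?T a e) = 0"
    if i: "i \<in> {1..n}" "\<not> (a i < N) \<or> \<not> (e i < N)" for a e i
  proof -
    obtain i' where "i' \<in> {1..n}" "\<not> (a (cyc n i') < N \<and> e i' < N)"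
      using i cyc_surj [OF i(1)] by metis
    thus ?thesis by (simp add: trunc_mult trunc_prod_mvar_0)
  qed
  have "trunc N (fsum ({1..n} \<rightarrow>\<^sub>E UNIV) (\<lambda>a. normal_D n a f)) =
      (\<Sum>a\<in>{1..n} \<rightarrow>\<^sub>E {..<N}. trunc N (normal_D n a f))"
  proof (rule trunc_fsum)
    fix a assume "a \<in> ({1..n} \<rightarrow>\<^sub>E UNIV) - ({1..n} \<rightarrow>\<^sub>E {..<N})"
    then obtain i where "i \<in> {1..n}" "\<not> a i < N" by (auto simp: PiE_iff)
    hence "trunc N (normal_D n a f) = (\<Sum>e\<in>{}. trunc N (?T a e))"
      unfolding normal_D_def by (intro trunc_fsum) (use zero in auto)
    thus "trunc N (normal_D n a f) = 0" by simp
  qed (auto simp: finite_PiE PiE_iff)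
  also have "\<dots> = (\<Sum>a\<in>{1..n} \<rightarrow>\<^sub>E {..<N}. \<Sum>e\<in>{1..n} \<rightarrow>\<^sub>E {..<N}. trunc N (?T a e))"
  proof (rule sum.cong [OF refl], unfold normal_D_def, rule trunc_fsum)
    fix a e assume "e \<in> ({1..n} \<rightarrow>\<^sub>E UNIV) - ({1..n} \<rightarrow>\<^sub>E {..<N})"
    then obtain i where "i \<in> {1..n}" "\<not> e i < N" by (auto simp: PiE_iff)
    thus "trunc N (?T a e) = 0" by (intro zero) auto
  qed (auto simp: finite_PiE PiE_iff)
  also have "\<dots> = (\<Sum>a\<in>{1..n} \<rightarrow>\<^sub>E {..<N}. \<Sum>e\<in>{1..n} \<rightarrow>\<^sub>E {..<N}.
      (\<Prod>i\<in>{1..n}. mvar (a (cyc n i), e i)) *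
      fold (\<lambda>i. mderiv (a i, e i)) [1..<n+1] (trunc N f))"
  proof (intro sum.cong refl)
    fix a e assume ae: "a \<in> {1..n} \<rightarrow>\<^sub>E {..<N}" "e \<in> {1..n} \<rightarrow>\<^sub>E {..<N}"
    have "a (cyc n i) < N" if "i \<in> {1..n}" for i
      using ae(1) cyc_bij [of n] that by (auto simp: PiE_iff bij_betw_def)
    hence "trunc N (\<Prod>i\<in>{1..n}. mvar (a (cyc n i), e i)) =
        (\<Prod>i\<in>{1..n}. mvar (a (cyc n i), e i))"
      unfolding trunc_prod
      by (intro prod.cong refl) (use ae(2) in \<open>auto simp: trunc_mvar PiE_iff\<close>)
    thus "trunc N (?T a e) = (\<Prod>i\<in>{1..n}. mvar (a (cyc n i), e i)) *
        fold (\<lambda>i. mderiv (a i, e i)) [1..<n+1] (trunc N f)"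
      using ae by (subst trunc_mult, subst fold) (auto simp: PiE_iff)
  qed
  finally show ?thesis by (simp add: Wop_def trunc_mult trunc_mconst)
qed


section \<open>Powers of the truncated matrix\<close>

fun matpow :: "nat \<Rightarrow> nat \<Rightarrow> nat \<Rightarrow> nat \<Rightarrow> xseries" where
  "matpow N 0 a b = (if a = b then 1 else 0)"
| "matpow N (Suc k) a b = (\<Sum>c<N. mvar (a, c) * matpow N k c b)"

definition mattr :: "nat \<Rightarrow> nat \<Rightarrow> xseries" where
  "mattr N k = (\<Sum>a<N. matpow N k a a)"

lemma matpow_add:
  assumes "a < N"
  shows "matpow N (j + k) a b = (\<Sum>c<N. matpow N j a c * matpow N k c b)"
  using assms
proof (induction j arbitrary: a)
  case 0
  have "(\<Sum>c<N. matpow N 0 a c * matpow N k c b) =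
      (\<Sum>c<N. if c = a then matpow N k a b else 0)"
    by (rule sum.cong) auto
  thus ?case using 0 by simp
next
  case (Suc j)
  have "matpow N (Suc j + k) a b =
      (\<Sum>d<N. \<Sum>c<N. mvar (a, d) * (matpow N j d c * matpow N k c b))"
    using Suc.IH by (simp add: sum_distrib_left)
  also have "\<dots> = (\<Sum>c<N. matpow N (Suc j) a c * matpow N k c b)"
    by (subst sum.swap) (simp add: sum_distrib_left sum_distrib_right ac_simps)
  finally show ?case .
qed

text \<open>
  Differentiating by the entry \<open>(b, d)\<close> removes one factor from the product, which falls apart into
  a part ending in row \<open>b\<close> and a part starting in column \<open>d\<close>.
\<close>

lemma mderiv_matpow:
  assumes "b < N" "d < N"
  shows "mderiv (b, d) (matpow N k u v) = (\<Sum>i<k. matpow N i u b * matpow N (k - 1 - i) d v)"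
proof (induction k arbitrary: u)
  case 0
  thus ?case by (simp add: mderiv_1 mderiv_0)
next
  case (Suc k)
  have "mderiv (b, d) (matpow N (Suc k) u v) =
      (\<Sum>c<N. (if b = u \<and> d = c then matpow N k c v else 0)) +
      (\<Sum>c<N. \<Sum>i<k. mvar (u, c) * (matpow N i c b * matpow N (k - 1 - i) d v))"
    by (simp add: mderiv_sum mderiv_mult mderiv_mvar Suc.IH sum_distrib_left sum.distrib
        if_distrib [of "\<lambda>x. x * _"] cong: if_cong)
  also have "(\<Sum>c<N. (if b = u \<and> d = c then matpow N k c v else 0)) =
      matpow N 0 u b * matpow N k d v"
    using assms by (cases "b = u") (auto cong: if_cong)
  also have "(\<Sum>c<N. \<Sum>i<k. mvar (u, c) * (matpow N i c b * matpow N (k - 1 - i) d v)) =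
      (\<Sum>i<k. matpow N (Suc i) u b * matpow N (k - 1 - i) d v)"
    by (subst sum.swap) (simp add: sum_distrib_right mult.assoc)
  finally show ?case by (simp del: sum.lessThan_Suc add: sum.lessThan_Suc_shift)
qed

lemma mderiv_mattr:
  assumes "b < N" "d < N"
  shows "mderiv (b, d) (mattr N k) = of_nat k * matpow N (k - 1) d b"
proof -
  have "mderiv (b, d) (mattr N k) =
      (\<Sum>i<k. \<Sum>a<N. matpow N (k - 1 - i) d a * matpow N i a b)"
    unfolding mattr_def mderiv_sum mderiv_matpow [OF assms]
    by (subst sum.swap) (simp add: mult.commute)
  also have "\<dots> = (\<Sum>i<k. matpow N (k - 1) d b)"
  proof (rule sum.cong [OF refl])
    fix i assume "i \<in> {..<k}"
    thus "(\<Sum>a<N. matpow N (k - 1 - i) d a * matpow N i a b) = matpow N (k - 1) d b"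
      using matpow_add [OF assms(2), of "k - 1 - i" i b] by simp
  qed
  finally show ?thesis by simp
qed

text \<open>
  Multiplying out a power of the matrix gives a sum over paths, with the end points left free. The
  function \<open>g\<close> of the end points makes the induction work, and it later closes the path to a cycle.
\<close>

lemma sum_paths:
  "(\<Sum>a\<in>{1..Suc k} \<rightarrow>\<^sub>E {..<N}. (\<Prod>i\<in>{1..k}. mvar (a (Suc i), a i)) * g (a 1) (a (Suc k))) =
   (\<Sum>u<N. \<Sum>v<N. matpow N k v u * g u v)"
proof (induction k arbitrary: g)
  case 0
  have "{1..Suc 0} = insert 1 {}" by auto
  hence "(\<Sum>a\<in>{1..Suc 0} \<rightarrow>\<^sub>E {..<N}. (\<Prod>i\<in>{1..0}. mvar (a (Suc i), a i)) * g (a 1) (a (Suc 0))) =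
      (\<Sum>c<N. g c c)"
    by (simp add: sum_PiE_insert)
  also have "\<dots> = (\<Sum>u<N. \<Sum>v<N. matpow N 0 v u * g u v)"
    by (rule sum.cong) (auto simp: if_distrib [of "\<lambda>x. x * _"] cong: if_cong)
  finally show ?case .
next
  case (Suc k)
  let ?g = "\<lambda>u v. \<Sum>w<N. mvar (w, v) * g u w"
  have ins: "{1..Suc (Suc k)} = insert (Suc (Suc k)) {1..Suc k}" by auto
  have "(\<Sum>a\<in>{1..Suc (Suc k)} \<rightarrow>\<^sub>E {..<N}. (\<Prod>i\<in>{1..Suc k}. mvar (a (Suc i), a i)) *
        g (a 1) (a (Suc (Suc k)))) =
      (\<Sum>a\<in>{1..Suc k} \<rightarrow>\<^sub>E {..<N}. \<Sum>w<N. (\<Prod>i\<in>{1..k}. mvar (a (Suc i), a i)) *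
        (mvar (w, a (Suc k)) * g (a 1) w))"
    unfolding ins by (subst sum_PiE_insert) (auto intro!: sum.cong simp: ac_simps)
  also have "\<dots> = (\<Sum>u<N. \<Sum>v<N. matpow N k v u * ?g u v)"
    unfolding Suc.IH [of ?g, symmetric] by (simp add: sum_distrib_left)
  also have "\<dots> = (\<Sum>u<N. \<Sum>w<N. matpow N (Suc k) w u * g u w)"
  proof (rule sum.cong [OF refl])
    fix u
    have "(\<Sum>v<N. matpow N k v u * ?g u v) =
        (\<Sum>v<N. \<Sum>w<N. mvar (w, v) * matpow N k v u * g u w)"
      by (simp add: sum_distrib_left ac_simps)
    also have "\<dots> = (\<Sum>w<N. matpow N (Suc k) w u * g u w)"
      by (subst sum.swap) (simp add: sum_distrib_right)
    finally show "(\<Sum>v<N. matpow N k v u * ?g u v) = (\<Sum>w<N. matpow N (Suc k) w u * g u w)" .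
  qed
  finally show ?case .
qed

lemma trunc_psum:
  assumes "k \<ge> 1"
  shows "trunc N (psum k) = mattr N k"
proof -
  obtain k' where k: "k = Suc k'" using assms by (cases k) auto
  have "trunc N (psum k) =
      (\<Sum>a\<in>{1..k} \<rightarrow>\<^sub>E {..<N}. trunc N (\<Prod>i\<in>{1..k}. mvar (a (cyc k i), a i)))"
    unfolding psum_def
  proof (rule trunc_fsum)
    fix a assume "a \<in> ({1..k} \<rightarrow>\<^sub>E UNIV) - ({1..k} \<rightarrow>\<^sub>E {..<N})"
    then obtain i where "i \<in> {1..k}" "\<not> a i < N" by (auto simp: PiE_iff)
    thus "trunc N (\<Prod>i\<in>{1..k}. mvar (a (cyc k i), a i)) = 0"
      by (intro trunc_prod_mvar_0) auto
  qed (auto simp: finite_PiE PiE_iff)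
  also have "\<dots> = (\<Sum>a\<in>{1..Suc k'} \<rightarrow>\<^sub>E {..<N}.
      (\<Prod>i\<in>{1..k'}. mvar (a (Suc i), a i)) * mvar (a 1, a (Suc k')))"
    unfolding k
  proof (rule sum.cong [OF refl])
    fix a assume "a \<in> {1..Suc k'} \<rightarrow>\<^sub>E {..<N}"
    hence "a i < N \<and> a (cyc (Suc k') i) < N" if "i \<in> {1..Suc k'}" for i
      using that cyc_bij [of "Suc k'"] by (auto simp: PiE_iff bij_betw_def)
    hence "trunc N (\<Prod>i\<in>{1..Suc k'}. mvar (a (cyc (Suc k') i), a i)) =
        (\<Prod>i\<in>{1..Suc k'}. mvar (a (cyc (Suc k') i), a i))"
      unfolding trunc_prod by (intro prod.cong refl) (auto simp: trunc_mvar)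
    also have "\<dots> = (\<Prod>i\<in>{1..k'}. mvar (a (Suc i), a i)) * mvar (a 1, a (Suc k'))"
      by (auto simp: cyc_def intro!: prod.cong)
    finally show "trunc N (\<Prod>i\<in>{1..Suc k'}. mvar (a (cyc (Suc k') i), a i)) =
        (\<Prod>i\<in>{1..k'}. mvar (a (Suc i), a i)) * mvar (a 1, a (Suc k'))" .
  qed
  \<comment> \<open>the path has one step less than the cycle; its end points are joined by the remaining entry\<close>
  also have "\<dots> = (\<Sum>u<N. \<Sum>v<N. matpow N k' v u * mvar (u, v))" by (rule sum_paths)
  also have "\<dots> = mattr N k"
    by (simp add: mattr_def k mult.commute)
  finally show ?thesis .
qed


section \<open>Products of matrix entries along the cycles of a permutation\<close>

text \<open>
  Composed with this transposition, \<open>\<alpha>\<close> sends the predecessor of \<open>x\<close> directly to the successor of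
  \<open>x\<close>: the point is cut out of its cycle, and all other cycles stay as they are.
\<close>

lemma orbit_bypass:
  assumes "finite S" "x \<notin> S" "\<alpha> permutes insert x S" "\<alpha> x \<noteq> x" "z \<in> S"
  shows "orbit (transpose x (\<alpha> x) \<circ> \<alpha>) z = orbit \<alpha> z - {x}"
proof -
  let ?\<alpha> = "transpose x (\<alpha> x) \<circ> \<alpha>"
  have perm: "?\<alpha> permutes S" by (rule permutes_insert_lemma) fact
  have sub: "orbit ?\<alpha> z \<subseteq> S" using perm assms(5) by (rule permutes_orbit_subset)
  have self: "z \<in> orbit ?\<alpha> z"
    using perm assms(1) by (intro permutation_self_in_orbit) (auto simp: permutation_permutes)
  have inj: "\<alpha> u = \<alpha> v \<longleftrightarrow> u = v" for u v using assms(3) by (metis permutes_inverses(2))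
  have step': "?\<alpha> u = (if \<alpha> u = x then \<alpha> x else \<alpha> u)" if "u \<noteq> x" for u
    using that inj by (auto simp: transpose_def)
  have sub_orbit: "u \<in> orbit \<alpha> z" if "u \<in> orbit ?\<alpha> z" for u
    using that
  proof (induction rule: orbit.induct)
    case base
    have "z \<noteq> x" using assms by auto
    have "\<alpha> z \<in> orbit \<alpha> z" by (rule orbit.base)
    moreover have "\<alpha> x \<in> orbit \<alpha> z" if "\<alpha> z = x"
      using orbit.step [OF calculation] that by simp
    ultimately show ?case unfolding step' [OF \<open>z \<noteq> x\<close>] by simp
  next
    case (step u)
    hence "u \<noteq> x" using sub assms(2) by auto
    have "\<alpha> u \<in> orbit \<alpha> z" using step.IH by (rule orbit.step)
    moreover have "\<alpha> x \<in> orbit \<alpha> z" if "\<alpha> u = x"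
      using orbit.step [OF calculation] that by simp
    ultimately show ?case using step' [OF \<open>u \<noteq> x\<close>] by simp
  qed
  have covers: "if u = x then inv \<alpha> x \<in> orbit ?\<alpha> z else u \<in> orbit ?\<alpha> z"
    if "u \<in> orbit \<alpha> z" for u
    using that
  proof (induction rule: orbit.induct)
    case base
    show ?case
    proof (cases "\<alpha> z = x")
      case True
      hence "inv \<alpha> x = z" using assms(3) by (metis permutes_inverses(2))
      thus ?thesis using True self by simp
    next
      case False
      hence "?\<alpha> z = \<alpha> z" using assms(2,5) step' [of z] by auto
      thus ?thesis using False orbit.base [of ?\<alpha> z] by simp
    qed
  next
    case (step u)
    show ?case
    proof (cases "u = x")
      case True
      have w: "\<alpha> (inv \<alpha> x) = x" using assms(3) by (rule permutes_inverses)
      hence "inv \<alpha> x \<noteq> x" using assms(4) by metis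
      hence "?\<alpha> (inv \<alpha> x) = \<alpha> x" using step' w by auto
      moreover have "inv \<alpha> x \<in> orbit ?\<alpha> z" using step.IH True by simp
      ultimately have "\<alpha> x \<in> orbit ?\<alpha> z" by (metis orbit.step)
      thus ?thesis using True assms(4) by simp
    next
      case False
      hence u: "u \<in> orbit ?\<alpha> z" using step.IH by simp
      show ?thesis
      proof (cases "\<alpha> u = x")
        case True
        hence "inv \<alpha> x = u" using assms(3) by (metis permutes_inverses(2))
        thus ?thesis using True u by simp
      next
        case neq: False
        hence "?\<alpha> u = \<alpha> u" using step' [OF False] by simp
        thus ?thesis using neq orbit.step [OF u] by simp
      qed
    qed
  qed
  show ?thesis
  proof (intro equalityI subsetI)
    fix u assume "u \<in> orbit \<alpha> z - {x}"
    thus "u \<in> orbit ?\<alpha> z" using covers [of u] by simp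
  next
    fix u assume "u \<in> orbit ?\<alpha> z"
    moreover from this have "u \<in> S" using sub by (rule rev_subsetD)
    ultimately show "u \<in> orbit \<alpha> z - {x}"
      using sub_orbit assms(2) by blast
  qed
qed

lemma orbit_eq_orbit:
  assumes "finite S" "\<alpha> permutes S" "y \<in> orbit \<alpha> x"
  shows "orbit \<alpha> y = orbit \<alpha> x"
proof -
  have "permutation \<alpha>" using assms(1,2) by (auto simp: permutation_permutes)
  hence "cyclic_on \<alpha> (orbit \<alpha> x)" by (rule cyclic_on_orbit')
  thus ?thesis using assms(3) unfolding cyclic_on_alldef by blast
qed

text \<open>
  The sum over the index attached to a point \<open>x\<close> composes the two powers that meet there, so that
  \<open>x\<close> disappears from its cycle while the exponents along the cycle keep their sum. A point that
  is alone in its cycle leaves a trace.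
\<close>

lemma sum_prod_matpow:
  fixes \<alpha> :: "'a \<Rightarrow> 'a" and k :: "'a \<Rightarrow> nat"
  assumes "finite S" "\<alpha> permutes S"
  shows "(\<Sum>a\<in>S \<rightarrow>\<^sub>E {..<N}. \<Prod>i\<in>S. matpow N (k (\<alpha> i)) (a i) (a (\<alpha> i))) =
    (\<Prod>c\<in>orbit \<alpha> ` S. mattr N (\<Sum>t\<in>c. k t))"
  using assms
proof (induction S arbitrary: \<alpha> k rule: finite_induct)
  case (insert x S)
  note perm = insert.prems
  have inn: "\<alpha> i \<in> insert x S" if "i \<in> insert x S" for i
    using perm that by (simp only: permutes_in_image)
  have inj: "\<alpha> u = \<alpha> v \<longleftrightarrow> u = v" for u v using perm by (metis permutes_inverses(2))
  show ?case
  proof (cases "\<alpha> x = x")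
    case True
    have perm': "\<alpha> permutes S"
      using perm by (rule permutes_superset) (use True in auto)
    have inS: "\<alpha> i \<in> S" if "i \<in> S" for i using perm' that by (simp only: permutes_in_image)
    have orb: "orbit \<alpha> i \<subseteq> S" if "i \<in> S" for i using perm' that by (rule permutes_orbit_subset)
    have "(\<Sum>a\<in>insert x S \<rightarrow>\<^sub>E {..<N}. \<Prod>i\<in>insert x S. matpow N (k (\<alpha> i)) (a i) (a (\<alpha> i))) =
        (\<Sum>a\<in>S \<rightarrow>\<^sub>E {..<N}. \<Sum>c<N. matpow N (k x) c c *
          (\<Prod>i\<in>S. matpow N (k (\<alpha> i)) (a i) (a (\<alpha> i))))"
      unfolding sum_PiE_insert [OF insert.hyps(2)]
    proof (intro sum.cong refl)
      fix a c
      have "(\<Prod>i\<in>S. matpow N (k (\<alpha> i)) ((a(x := c)) i) ((a(x := c)) (\<alpha> i))) =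
          (\<Prod>i\<in>S. matpow N (k (\<alpha> i)) (a i) (a (\<alpha> i)))"
        by (rule prod.cong) (use inS insert.hyps in auto)
      thus "(\<Prod>i\<in>insert x S. matpow N (k (\<alpha> i)) ((a(x := c)) i) ((a(x := c)) (\<alpha> i))) =
          matpow N (k x) c c * (\<Prod>i\<in>S. matpow N (k (\<alpha> i)) (a i) (a (\<alpha> i)))"
        using insert.hyps True by simp
    qed
    also have "\<dots> = mattr N (k x) *
        (\<Sum>a\<in>S \<rightarrow>\<^sub>E {..<N}. \<Prod>i\<in>S. matpow N (k (\<alpha> i)) (a i) (a (\<alpha> i)))"
      unfolding mattr_def sum_product by (rule sum.swap)
    also have "\<dots> = mattr N (k x) * (\<Prod>c\<in>orbit \<alpha> ` S. mattr N (\<Sum>t\<in>c. k t))"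
      by (simp only: insert.IH [OF perm'])
    also have "\<dots> = (\<Prod>c\<in>insert {x} (orbit \<alpha> ` S). mattr N (\<Sum>t\<in>c. k t))"
      using insert.hyps orb by (subst prod.insert) auto
    also have "insert {x} (orbit \<alpha> ` S) = orbit \<alpha> ` insert x S"
      using True by (simp add: orbit_eq_singleton_iff [THEN iffD2])
    finally show ?thesis .
  next
    case False
    define y where "y = \<alpha> x"
    define w where "w = inv \<alpha> x"
    define \<alpha>' where "\<alpha>' = transpose x y \<circ> \<alpha>"
    \<comment> \<open>the successor \<open>y\<close> of \<open>x\<close> inherits its exponent, the predecessor \<open>w\<close> is sent to \<open>y\<close>\<close>
    define k' where "k' = k(y := k x + k y)"
    have aw: "\<alpha> w = x" unfolding w_def using perm by (rule permutes_inverses)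
    have y: "y \<in> S" "y \<noteq> x"
      using inn [of x] False unfolding y_def by auto
    have "w \<in> insert x S" using aw permutes_in_image [OF perm, of w] by simp
    moreover have "w \<noteq> x" using aw False by metis
    ultimately have w: "w \<in> S" by simp
    have perm': "\<alpha>' permutes S"
      unfolding \<alpha>'_def y_def by (rule permutes_insert_lemma) fact
    have \<alpha>': "\<alpha>' i = (if i = w then y else \<alpha> i)" "i \<noteq> w \<Longrightarrow> \<alpha> i \<noteq> x" "i \<noteq> x \<Longrightarrow> \<alpha> i \<noteq> y"
      if "i \<in> S" for i
      using that insert.hyps aw inj by (auto simp: \<alpha>'_def y_def transpose_def)
    have split: "(\<Prod>i\<in>S. g i) = g w * (\<Prod>i\<in>S - {w}. g i)" for g :: "'a \<Rightarrow> xseries"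
      using insert.hyps w by (simp add: prod.remove)
    have "(\<Sum>a\<in>insert x S \<rightarrow>\<^sub>E {..<N}. \<Prod>i\<in>insert x S. matpow N (k (\<alpha> i)) (a i) (a (\<alpha> i))) =
        (\<Sum>a\<in>S \<rightarrow>\<^sub>E {..<N}. \<Prod>i\<in>S. matpow N (k' (\<alpha>' i)) (a i) (a (\<alpha>' i)))"
      unfolding sum_PiE_insert [OF insert.hyps(2)]
    proof (rule sum.cong [OF refl])
      fix a assume a: "a \<in> S \<rightarrow>\<^sub>E {..<N}"
      let ?R = "\<Prod>i\<in>S - {w}. matpow N (k (\<alpha> i)) (a i) (a (\<alpha> i))"
      have "(\<Prod>i\<in>insert x S. matpow N (k (\<alpha> i)) ((a(x := c)) i) ((a(x := c)) (\<alpha> i))) =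
          matpow N (k x) (a w) c * matpow N (k y) c (a y) * ?R" for c
      proof -
        have "(\<Prod>i\<in>S - {w}. matpow N (k (\<alpha> i)) ((a(x := c)) i) ((a(x := c)) (\<alpha> i))) = ?R"
          by (rule prod.cong) (use insert.hyps \<alpha>' in auto)
        moreover have "w \<noteq> x" using w insert.hyps by auto
        ultimately show ?thesis
          using insert.hyps aw y by (simp add: split y_def [symmetric])
      qed
      hence "(\<Sum>c<N. \<Prod>i\<in>insert x S. matpow N (k (\<alpha> i)) ((a(x := c)) i) ((a(x := c)) (\<alpha> i))) =
          (\<Sum>c<N. matpow N (k x) (a w) c * matpow N (k y) c (a y)) * ?R"
        by (simp only: sum_distrib_right)
      also have "(\<Sum>c<N. matpow N (k x) (a w) c * matpow N (k y) c (a y)) =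
          matpow N (k' (\<alpha>' w)) (a w) (a (\<alpha>' w))"
        using a w \<alpha>'(1) [OF w] by (subst matpow_add [symmetric]) (auto simp: k'_def)
      also have "?R = (\<Prod>i\<in>S - {w}. matpow N (k' (\<alpha>' i)) (a i) (a (\<alpha>' i)))"
        by (rule prod.cong) (use insert.hyps \<alpha>' in \<open>auto simp: k'_def\<close>)
      finally show "(\<Sum>c<N. \<Prod>i\<in>insert x S.
            matpow N (k (\<alpha> i)) ((a(x := c)) i) ((a(x := c)) (\<alpha> i))) =
          (\<Prod>i\<in>S. matpow N (k' (\<alpha>' i)) (a i) (a (\<alpha>' i)))"
        unfolding split .
    qed
    also have "\<dots> = (\<Prod>c\<in>orbit \<alpha>' ` S. mattr N (\<Sum>t\<in>c. k' t))"
      by (rule insert.IH [OF perm'])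
    also have "orbit \<alpha>' ` S = (\<lambda>c. c - {x}) ` orbit \<alpha> ` S"
      unfolding image_image \<alpha>'_def y_def
      using insert.hyps perm False by (intro image_cong orbit_bypass) auto
    also have "(\<Prod>c\<in>(\<lambda>c. c - {x}) ` orbit \<alpha> ` S. mattr N (\<Sum>t\<in>c. k' t)) =
        (\<Prod>c\<in>orbit \<alpha> ` S. mattr N (\<Sum>t\<in>c. k t))"
    proof (subst prod.reindex)
      have fin: "finite (insert x S)" using insert.hyps by simp
      have self: "z \<in> orbit \<alpha> z" for z
        using perm fin by (intro permutation_self_in_orbit) (auto simp: permutation_permutes)
      show "inj_on (\<lambda>c. c - {x}) (orbit \<alpha> ` S)"
      proof (rule inj_onI, clarify)
        fix u v assume uv: "u \<in> S" "v \<in> S" "orbit \<alpha> u - {x} = orbit \<alpha> v - {x}"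
        hence "u \<in> orbit \<alpha> v" using self [of u] insert.hyps by auto
        thus "orbit \<alpha> u = orbit \<alpha> v" by (rule orbit_eq_orbit [OF fin perm])
      qed
      show "prod ((\<lambda>c. mattr N (\<Sum>t\<in>c. k' t)) \<circ> (\<lambda>c. c - {x})) (orbit \<alpha> ` S) =
          (\<Prod>c\<in>orbit \<alpha> ` S. mattr N (\<Sum>t\<in>c. k t))"
      proof (rule prod.cong [OF refl], clarify)
        fix u assume "u \<in> S"
        hence "orbit \<alpha> u \<subseteq> insert x S" using perm by (intro permutes_orbit_subset) auto
        hence fin': "finite (orbit \<alpha> u)" using fin by (rule finite_subset)
        have "(\<Sum>t\<in>orbit \<alpha> u - {x}. k' t) = (\<Sum>t\<in>orbit \<alpha> u. k t)"
        proof (cases "x \<in> orbit \<alpha> u")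
          case True
          hence "y \<in> orbit \<alpha> u" unfolding y_def by (rule orbit.step)
          with y have "y \<in> orbit \<alpha> u - {x}" by simp
          have "(\<Sum>t\<in>orbit \<alpha> u - {x}. k' t) = k' y + (\<Sum>t\<in>orbit \<alpha> u - {x} - {y}. k' t)"
            using fin' \<open>y \<in> orbit \<alpha> u - {x}\<close> by (intro sum.remove) auto
          also have "\<dots> = k x + (k y + (\<Sum>t\<in>orbit \<alpha> u - {x} - {y}. k t))"
            by (simp add: k'_def)
          also have "k y + (\<Sum>t\<in>orbit \<alpha> u - {x} - {y}. k t) = (\<Sum>t\<in>orbit \<alpha> u - {x}. k t)"
            using fin' \<open>y \<in> orbit \<alpha> u - {x}\<close> by (intro sum.remove [symmetric]) auto
          also have "k x + \<dots> = (\<Sum>t\<in>orbit \<alpha> u. k t)"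
            using fin' True by (intro sum.remove [symmetric]) auto
          finally show ?thesis .
        next
          case x: False
          have "y \<notin> orbit \<alpha> u"
          proof
            assume "y \<in> orbit \<alpha> u"
            hence "orbit \<alpha> y = orbit \<alpha> u" by (rule orbit_eq_orbit [OF fin perm])
            moreover have "orbit \<alpha> y = orbit \<alpha> x"
              unfolding y_def by (intro orbit_eq_orbit [OF fin perm] orbit.base)
            ultimately show False using x self by metis
          qed
          thus ?thesis using x by (auto simp: k'_def intro!: sum.cong)
        qed
        thus "((\<lambda>c. mattr N (\<Sum>t\<in>c. k' t)) \<circ> (\<lambda>c. c - {x})) (orbit \<alpha> u) =
            mattr N (\<Sum>t\<in>orbit \<alpha> u. k t)" by simp
      qed
    qed
    also have "orbit \<alpha> ` S = orbit \<alpha> ` insert x S"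
    proof -
      have "orbit \<alpha> x = orbit \<alpha> y"
        unfolding y_def using insert.hyps perm
        by (intro orbit_eq_orbit [of "insert x S", symmetric] orbit.base) auto
      thus ?thesis using y by auto
    qed
    finally show ?thesis .
  qed
qed simp


section \<open>Derivatives indexed by the blocks of a set partition\<close>

lemma fold_kderiv_insert:
  assumes "finite P" "B \<notin> P"
  shows "Finite_Set.fold (kderiv k) F (insert B P) = kderiv k B (Finite_Set.fold (kderiv k) F P)"
proof -
  interpret comp_fun_commute "kderiv k" by (rule comp_fun_commute_kderiv)
  show ?thesis using assms by simp
qed

lemma fold_kderiv_reindex:
  assumes "finite P" "inj_on g P" "\<And>B. B \<in> P \<Longrightarrow> (\<Sum>t\<in>g B. k t) = (\<Sum>t\<in>B. k' t)"
  shows "Finite_Set.fold (kderiv k) F (g ` P) = Finite_Set.fold (kderiv k') F P"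
  using assms
proof (induction P rule: finite_induct)
  case (insert B P)
  have "kderiv k (g B) = kderiv k' B" using insert.prems by (simp add: kderiv_def fun_eq_iff)
  moreover have "g B \<notin> g ` P" using insert by auto
  ultimately show ?case using insert by (simp add: fold_kderiv_insert)
qed simp

lemma fold_kderiv_vars:
  assumes "finite P"
  shows "\<Union> (set_mset ` Poly_Mapping.keys (Finite_Set.fold (kderiv k) F P))
    \<subseteq> \<Union> (set_mset ` Poly_Mapping.keys F)"
  using assms
proof (induction P rule: finite_induct)
  case (insert B P)
  thus ?case
    using kderiv_vars [of k B "Finite_Set.fold (kderiv k) F P"] by (simp add: fold_kderiv_insert)
qed simp

definition block_deriv :: "nat \<Rightarrow> (nat \<Rightarrow> nat) \<Rightarrow> (nat \<Rightarrow> nat) \<Rightarrow> ppoly \<Rightarrow> ppoly" where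
  "block_deriv n \<alpha> k F = Finite_Set.fold (kderiv k) F (setpart n \<alpha>)"

lemma block_deriv_bracket_0:
  assumes "n \<ge> 1" "\<alpha> permutes {1..n}"
  shows "block_deriv (n + 1) (bracket n \<alpha> 0) (k(n + 1 := c)) F =
    of_nat c * pdiff c (block_deriv n \<alpha> k F)"
proof -
  note fin = setpart_finite_Union [OF assms]
  have "block_deriv (n + 1) (bracket n \<alpha> 0) (k(n + 1 := c)) F =
      Finite_Set.fold (kderiv (k(n + 1 := c))) F (insert {n + 1} (setpart n \<alpha>))"
    using setpart_bracket [OF assms, of 0] by (simp add: block_deriv_def)
  also have "\<dots> = kderiv (k(n + 1 := c)) {n + 1}
      (Finite_Set.fold (kderiv (k(n + 1 := c))) F (setpart n \<alpha>))"
  proof (rule fold_kderiv_insert)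
    have "n + 1 \<notin> \<Union> (setpart n \<alpha>)" using fin by simp
    thus "{n + 1} \<notin> setpart n \<alpha>" by blast
  qed (use fin in simp)
  also have "Finite_Set.fold (kderiv (k(n + 1 := c))) F (setpart n \<alpha>) = block_deriv n \<alpha> k F"
  proof -
    have "(\<Sum>t\<in>B. (k(n + 1 := c)) t) = (\<Sum>t\<in>B. k t)" if "B \<in> setpart n \<alpha>" for B
    proof (rule sum.cong [OF refl])
      fix t assume "t \<in> B"
      hence "t \<in> {1..n}" using fin that by auto
      thus "(k(n + 1 := c)) t = k t" by auto
    qed
    hence "Finite_Set.fold (kderiv (k(n + 1 := c))) F (id ` setpart n \<alpha>) =
        Finite_Set.fold (kderiv k) F (setpart n \<alpha>)"
      using fin by (intro fold_kderiv_reindex) simp_all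
    thus ?thesis by (simp add: block_deriv_def)
  qed
  also have "kderiv (k(n + 1 := c)) {n + 1} (block_deriv n \<alpha> k F) =
      of_nat c * pdiff c (block_deriv n \<alpha> k F)"
    by (simp add: kderiv_def)
  finally show ?thesis .
qed

text \<open>
  The new point joins the block of \<open>j\<close>. The derivative sees only the sums of \<open>k\<close> over the blocks, so
  the value at the new point may be added to the value at \<open>j\<close> instead.
\<close>

lemma block_deriv_bracket:
  assumes "n \<ge> 1" "\<alpha> permutes {1..n}" "j \<in> {1..n}"
  shows "block_deriv (n + 1) (bracket n \<alpha> j) (k(n + 1 := c)) F =
    block_deriv n \<alpha> (k(j := k j + c)) F"
proof -
  note fin = setpart_finite_Union [OF assms(1,2)]
  let ?g = "\<lambda>B. if j \<in> B then B \<union> {n + 1} else B"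
  have sub: "B \<subseteq> {1..n}" if "B \<in> setpart n \<alpha>" for B using fin that by auto
  have "setpart (n + 1) (bracket n \<alpha> j) = ?g ` setpart n \<alpha>"
    using setpart_bracket [OF assms(1,2), of j] assms(3) by simp
  moreover have "Finite_Set.fold (kderiv (k(n + 1 := c))) F (?g ` setpart n \<alpha>) =
      Finite_Set.fold (kderiv (k(j := k j + c))) F (setpart n \<alpha>)"
  proof (rule fold_kderiv_reindex)
    have "?g B - {n + 1} = B" if "B \<in> setpart n \<alpha>" for B using sub [OF that] by auto
    thus "inj_on ?g (setpart n \<alpha>)" by (rule inj_on_inverseI [where g = "\<lambda>B. B - {n + 1}"])
    fix B assume "B \<in> setpart n \<alpha>"
    hence B: "B \<subseteq> {1..n}" "finite B" using sub finite_subset by blast+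
    have "n + 1 \<notin> B" using B by auto
    hence k: "(\<Sum>t\<in>B. (k(n + 1 := c)) t) = (\<Sum>t\<in>B. k t)"
      by (intro sum.cong) auto
    show "(\<Sum>t\<in>?g B. (k(n + 1 := c)) t) = (\<Sum>t\<in>B. (k(j := k j + c)) t)"
    proof (cases "j \<in> B")
      case True
      have "(\<Sum>t\<in>B. (k(j := k j + c)) t) = (\<Sum>t\<in>B. k t) + c"
        using B True by (simp add: sum.remove [of B j])
      thus ?thesis using True B k \<open>n + 1 \<notin> B\<close> by simp
    next
      case False
      have "(\<Sum>t\<in>B. (k(j := k j + c)) t) = (\<Sum>t\<in>B. k t)"
        by (intro sum.cong) (use False in auto)
      thus ?thesis using False k by simp
    qed
  qed (use fin in simp)
  ultimately show ?thesis by (simp add: block_deriv_def)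
qed

text \<open>
  A block containing a point of value above \<open>K\<close> asks for the derivative by an indeterminate of
  index above \<open>K\<close>. This bounds the otherwise infinite range of the exponents.
\<close>

lemma block_deriv_eq_0:
  assumes "n \<ge> 1" "\<alpha> permutes {1..n}" "\<Union> (set_mset ` Poly_Mapping.keys F) \<subseteq> {1..K}"
    "t \<in> {1..n}" "k t > K"
  shows "block_deriv n \<alpha> k F = 0"
proof (rule ccontr)
  note fin = setpart_finite_Union [OF assms(1,2)]
  assume *: "block_deriv n \<alpha> k F \<noteq> 0"
  have "t \<in> \<Union> (setpart n \<alpha>)" using fin assms(4) by simp
  then obtain B where B: "B \<in> setpart n \<alpha>" "t \<in> B" by (rule UnionE)
  have "(\<Sum>t\<in>B. k t) \<in> \<Union> (set_mset ` Poly_Mapping.keys F)"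
    using conjunct1 [OF fin] * B(1) unfolding block_deriv_def by (rule fold_kderiv_nonzero)
  hence "(\<Sum>t\<in>B. k t) \<in> {1..K}" using assms(3) by (rule rev_subsetD)
  moreover have "finite B" using fin B(1) by (metis Union_upper finite_atLeastAtMost finite_subset)
  hence "k t \<le> (\<Sum>t\<in>B. k t)" using B(2) by (intro member_le_sum) auto
  ultimately show False using assms(5) by simp
qed


section \<open>Iterated derivatives of a polynomial in the traces\<close>

text \<open>
  The arrow of the quiver with source \<open>i + 1\<close>, for \<open>1 \<le> i \<le> n\<close>, has the target \<open>\<alpha> (cyc n i)\<close>: the
  source \<open>n + 1\<close> takes the place of \<open>1\<close>. It carries a power of the matrix whose first factor \<open>X\<close>
  is the one in front of the derivatives. What remains goes from the column index \<open>e\<^sub>i\<close> of that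
  factor to the row index at the target.
\<close>

definition arrow_entries ::
  "nat \<Rightarrow> nat \<Rightarrow> (nat \<Rightarrow> nat) \<Rightarrow> (nat \<Rightarrow> nat) \<Rightarrow> (nat \<Rightarrow> nat) \<Rightarrow> (nat \<Rightarrow> nat) \<Rightarrow> xseries" where
  "arrow_entries N n \<alpha> k a e =
     (\<Prod>i\<in>{1..n}. matpow N (k (\<alpha> (cyc n i)) - 1) (e i) (a (\<alpha> (cyc n i))))"

definition quiver_term ::
  "nat \<Rightarrow> nat \<Rightarrow> ppoly \<Rightarrow> (nat \<Rightarrow> nat) \<Rightarrow> (nat \<Rightarrow> nat) \<Rightarrow> (nat \<Rightarrow> nat) \<Rightarrow> (nat \<Rightarrow> nat) \<Rightarrow> xseries" where
  "quiver_term N n F a e \<alpha> k =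
     arrow_entries N n \<alpha> k a e * peval (mattr N) (block_deriv n \<alpha> k F)"

text \<open>
  Precomposition with the cyclic successor enumerates the targets of the arrows in the order of
  their sources. In this form \<open>[\<alpha>, j]\<close> arises from \<open>\<alpha>\<close>, with the new point fixed, by a single
  transposition of targets.
\<close>

lemma bracket_cyc:
  assumes "n \<ge> 1" "\<alpha> permutes {1..n}" "j \<le> n"
  shows "i \<in> {1..n} \<Longrightarrow> bracket n \<alpha> j (cyc (n + 1) i) =
      transpose (if j = 0 then n + 1 else j) (n + 1) (\<alpha> (cyc n i))"
    and "bracket n \<alpha> j (cyc (n + 1) (n + 1)) = (if j = 0 then n + 1 else j)"
proof -
  show "bracket n \<alpha> j (cyc (n + 1) i) =
      transpose (if j = 0 then n + 1 else j) (n + 1) (\<alpha> (cyc n i))" if "i \<in> {1..n}"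
  proof -
    have "transpose 1 (n + 1) (cyc (n + 1) i) = cyc n i"
      using that by (auto simp: cyc_def transpose_def)
    thus ?thesis unfolding bracket_eq [OF assms] by simp
  qed
  have "\<alpha> (n + 1) = n + 1" using assms(2) by (auto simp: permutes_def)
  thus "bracket n \<alpha> j (cyc (n + 1) (n + 1)) = (if j = 0 then n + 1 else j)"
    unfolding bracket_eq [OF assms] by (simp add: cyc_def)
qed

lemma perm_cyc_bij:
  assumes "\<alpha> permutes {1..n}"
  shows "bij_betw (\<lambda>i. \<alpha> (cyc n i)) {1..n} {1..n}"
  using bij_betw_trans [OF cyc_bij permutes_imp_bij [OF assms]] by (simp add: o_def)

lemma perm_cyc_neq:
  assumes "\<alpha> permutes {1..n}" "i \<in> {1..n} - {l}" "l \<in> {1..n}"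
  shows "\<alpha> (cyc n i) \<noteq> \<alpha> (cyc n l)"
  using inj_on_eq_iff [OF bij_betw_imp_inj_on [OF perm_cyc_bij [OF assms(1)]], of i l] assms(2,3)
  by blast

lemma arrow_entries_bracket_0:
  assumes "n \<ge> 1" "\<alpha> permutes {1..n}"
  shows "arrow_entries N (n + 1) (bracket n \<alpha> 0) (k(n + 1 := c)) a e =
    matpow N (c - 1) (e (n + 1)) (a (n + 1)) * arrow_entries N n \<alpha> k a e"
proof -
  let ?h = "\<lambda>i. matpow N ((k(n + 1 := c)) (bracket n \<alpha> 0 (cyc (n + 1) i)) - 1) (e i)
        (a (bracket n \<alpha> 0 (cyc (n + 1) i)))"
  have "arrow_entries N (n + 1) (bracket n \<alpha> 0) (k(n + 1 := c)) a e = (\<Prod>i\<in>{1..n}. ?h i) * ?h (n + 1)"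
    by (simp add: arrow_entries_def)
  also have "(\<Prod>i\<in>{1..n}. ?h i) = arrow_entries N n \<alpha> k a e"
    unfolding arrow_entries_def
  proof (rule prod.cong [OF refl])
    fix i assume i: "i \<in> {1..n}"
    hence "\<alpha> (cyc n i) \<in> {1..n}" using perm_cyc_bij [OF assms(2)] by (auto simp: bij_betw_def)
    hence "\<alpha> (cyc n i) \<noteq> n + 1" by simp
    moreover have "bracket n \<alpha> 0 (cyc (n + 1) i) = \<alpha> (cyc n i)"
      using bracket_cyc(1) [OF assms, of 0 i] i by simp
    ultimately show "?h i = matpow N (k (\<alpha> (cyc n i)) - 1) (e i) (a (\<alpha> (cyc n i)))"
      by simp
  qed
  also have "?h (n + 1) = matpow N (c - 1) (e (n + 1)) (a (n + 1))"
    using bracket_cyc(2) [OF assms, of 0] by simp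
  finally show ?thesis by (simp only: mult.commute)
qed

text \<open>
  The arrow from \<open>l + 1\<close> to \<open>j\<close> is redirected to \<open>n + 1\<close>, and the new source \<open>n + 2\<close> takes over the
  target \<open>j\<close>.
\<close>

lemma arrow_entries_bracket:
  assumes "n \<ge> 1" "\<alpha> permutes {1..n}" "l \<in> {1..n}" "j = \<alpha> (cyc n l)"
  shows "arrow_entries N (n + 1) (bracket n \<alpha> j) (k(n + 1 := c)) a e =
    matpow N (c - 1) (e l) (a (n + 1)) * matpow N (k j - 1) (e (n + 1)) (a j) *
    (\<Prod>i\<in>{1..n} - {l}. matpow N (k (\<alpha> (cyc n i)) - 1) (e i) (a (\<alpha> (cyc n i))))"
proof -
  note bij = perm_cyc_bij [OF assms(2)]
  have j: "j \<in> {1..n}" using bij assms(3,4) by (auto simp: bij_betw_def)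
  let ?h = "\<lambda>i. matpow N ((k(n + 1 := c)) (bracket n \<alpha> j (cyc (n + 1) i)) - 1) (e i)
        (a (bracket n \<alpha> j (cyc (n + 1) i)))"
  have br: "bracket n \<alpha> j (cyc (n + 1) i) = transpose j (n + 1) (\<alpha> (cyc n i))"
    if "i \<in> {1..n}" for i
    using bracket_cyc(1) [OF assms(1,2), of j i] j that by simp
  have "arrow_entries N (n + 1) (bracket n \<alpha> j) (k(n + 1 := c)) a e = (\<Prod>i\<in>{1..n}. ?h i) * ?h (n + 1)"
    by (simp add: arrow_entries_def)
  also have "(\<Prod>i\<in>{1..n}. ?h i) = ?h l * (\<Prod>i\<in>{1..n} - {l}. ?h i)"
    using assms(3) by (intro prod.remove) auto
  also have "?h l = matpow N (c - 1) (e l) (a (n + 1))"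
    using br [OF assms(3)] by (simp flip: assms(4))
  also have "(\<Prod>i\<in>{1..n} - {l}. ?h i) =
      (\<Prod>i\<in>{1..n} - {l}. matpow N (k (\<alpha> (cyc n i)) - 1) (e i) (a (\<alpha> (cyc n i))))"
  proof (rule prod.cong [OF refl])
    fix i assume i: "i \<in> {1..n} - {l}"
    have "\<alpha> (cyc n i) \<in> {1..n}" using bij i by (auto simp: bij_betw_def)
    moreover have "\<alpha> (cyc n i) \<noteq> j"
      unfolding assms(4) using assms(2) i assms(3) by (rule perm_cyc_neq)
    ultimately have "bracket n \<alpha> j (cyc (n + 1) i) = \<alpha> (cyc n i)" "\<alpha> (cyc n i) \<noteq> n + 1"
      using br [of i] i by (auto simp: transpose_def)
    thus "?h i = matpow N (k (\<alpha> (cyc n i)) - 1) (e i) (a (\<alpha> (cyc n i)))" by simp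
  qed
  also have "?h (n + 1) = matpow N (k j - 1) (e (n + 1)) (a j)"
  proof -
    have "bracket n \<alpha> j (cyc (n + 1) (n + 1)) = j"
      using bracket_cyc(2) [OF assms(1,2), of j] j by simp
    moreover have "j \<noteq> n + 1" using j by simp
    ultimately show ?thesis by simp
  qed
  finally show ?thesis by (simp only: ac_simps)
qed

text \<open>
  Cutting an arrow of weight \<open>m \<le> K\<close> gives the pairs of weights \<open>d, c \<ge> 1\<close> with \<open>d + c = m\<close>, whereas the
  quivers of the next level range over all pairs up to \<open>K\<close>. The difference consists of the pairs with
  \<open>d + c > K\<close>, for which the coefficient \<open>E\<close> vanishes.
\<close>

lemma sum_split_exponent:
  fixes A B E :: "nat \<Rightarrow> 'a::comm_ring_1"
  assumes "\<And>m. m > K \<Longrightarrow> E m = 0"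
  shows "(\<Sum>d\<in>{1..K}. \<Sum>c\<in>{1..K}. B (c - 1) * A (d - 1) * E (d + c)) =
    (\<Sum>m\<in>{1..K}. (\<Sum>i<m - 1. B i * A (m - 1 - 1 - i)) * E m)"
proof -
  have "(\<Sum>d\<in>{1..K}. \<Sum>c\<in>{1..K}. B (c - 1) * A (d - 1) * E (d + c)) =
      (\<Sum>(d, c)\<in>{1..K} \<times> {1..K}. B (c - 1) * A (d - 1) * E (d + c))"
    by (rule sum.cartesian_product)
  also have "\<dots> = (\<Sum>(d, c)\<in>{(d, c). 1 \<le> d \<and> 1 \<le> c \<and> d + c \<le> K}. B (c - 1) * A (d - 1) * E (d + c))"
  proof (rule sum.mono_neutral_right)
    have "B (c - 1) * A (d - 1) * E (d + c) = 0" if "\<not> d + c \<le> K" for d c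
      using assms [of "d + c"] that by simp
    thus "\<forall>i\<in>{1..K} \<times> {1..K} - {(d, c). 1 \<le> d \<and> 1 \<le> c \<and> d + c \<le> K}.
        (case i of (d, c) \<Rightarrow> B (c - 1) * A (d - 1) * E (d + c)) = 0" by auto
  qed auto
  also have "\<dots> = (\<Sum>(m, i)\<in>(SIGMA m:{1..K}. {..<m - 1}). B i * A (m - 1 - 1 - i) * E m)"
    by (rule sum.reindex_bij_witness [where i = "\<lambda>(m, i). (m - 1 - i, i + 1)"
          and j = "\<lambda>(d, c). (d + c, c - 1)"]) auto
  also have "\<dots> = (\<Sum>m\<in>{1..K}. (\<Sum>i<m - 1. B i * A (m - 1 - 1 - i)) * E m)"
    by (simp add: sum_distrib_right flip: sum.Sigma)
  finally show ?thesis .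
qed

text \<open>
  The chain rule: the value \<open>c\<close> at the new point is the index of the indeterminate by which the
  polynomial is differentiated.
\<close>

lemma sum_quiver_term_bracket_0:
  assumes "n \<ge> 1" "\<alpha> permutes {1..n}" "a (n + 1) < N" "e (n + 1) < N"
    and vars: "\<Union> (set_mset ` Poly_Mapping.keys F) \<subseteq> {1..K}"
  shows "(\<Sum>k\<in>{1..n+1} \<rightarrow>\<^sub>E {1..K}. quiver_term N (n + 1) F a e (bracket n \<alpha> 0) k) =
    (\<Sum>k\<in>{1..n} \<rightarrow>\<^sub>E {1..K}. arrow_entries N n \<alpha> k a e *
      mderiv (a (n + 1), e (n + 1)) (peval (mattr N) (block_deriv n \<alpha> k F)))"
proof -
  have ins: "{1..n+1} = insert (n + 1) {1..n}" by auto
  have "(\<Sum>c\<in>{1..K}. quiver_term N (n + 1) F a e (bracket n \<alpha> 0) (k(n + 1 := c))) =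
      arrow_entries N n \<alpha> k a e *
      mderiv (a (n + 1), e (n + 1)) (peval (mattr N) (block_deriv n \<alpha> k F))" for k
  proof -
    have "\<Union> (set_mset ` Poly_Mapping.keys (block_deriv n \<alpha> k F)) \<subseteq> {1..K}"
      using fold_kderiv_vars [of "setpart n \<alpha>" k F] setpart_finite_Union [OF assms(1,2)] vars
      unfolding block_deriv_def by (meson order_trans)
    hence "mderiv (a (n + 1), e (n + 1)) (peval (mattr N) (block_deriv n \<alpha> k F)) =
        (\<Sum>c\<in>{1..K}. of_nat c * matpow N (c - 1) (e (n + 1)) (a (n + 1)) *
          peval (mattr N) (pdiff c (block_deriv n \<alpha> k F)))"
      by (subst mderiv_peval [of "{1..K}"]) (simp_all only: mderiv_mattr [OF assms(3,4)] finite_atLeastAtMost)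
    moreover have "quiver_term N (n + 1) F a e (bracket n \<alpha> 0) (k(n + 1 := c)) =
        arrow_entries N n \<alpha> k a e * (of_nat c * matpow N (c - 1) (e (n + 1)) (a (n + 1)) *
          peval (mattr N) (pdiff c (block_deriv n \<alpha> k F)))" for c
      unfolding quiver_term_def arrow_entries_bracket_0 [OF assms(1,2)]
        block_deriv_bracket_0 [OF assms(1,2)] peval_of_nat_times
      by (simp only: ac_simps)
    ultimately show ?thesis by (simp only: sum_distrib_left)
  qed
  thus ?thesis unfolding ins by (subst sum_PiE_insert) simp_all
qed

text \<open>
  The values at \<open>j\<close> and at the new point are the weights of the two parts of the arrow that is cut.
  Fixing all other values reduces the claim to \<open>sum_split_exponent\<close>.
\<close>

lemma sum_quiver_term_bracket:
  assumes "n \<ge> 1" "\<alpha> permutes {1..n}" "a (n + 1) < N" "e (n + 1) < N"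
    and vars: "\<Union> (set_mset ` Poly_Mapping.keys F) \<subseteq> {1..K}"
    and l: "l \<in> {1..n}" "j = \<alpha> (cyc n l)"
  shows "(\<Sum>k\<in>{1..n+1} \<rightarrow>\<^sub>E {1..K}. quiver_term N (n + 1) F a e (bracket n \<alpha> j) k) =
    (\<Sum>k\<in>{1..n} \<rightarrow>\<^sub>E {1..K}. mderiv (a (n + 1), e (n + 1)) (matpow N (k j - 1) (e l) (a j)) *
      (\<Prod>i\<in>{1..n} - {l}. matpow N (k (\<alpha> (cyc n i)) - 1) (e i) (a (\<alpha> (cyc n i)))) *
      peval (mattr N) (block_deriv n \<alpha> k F))"
proof -
  note bij = perm_cyc_bij [OF assms(2)]
  have j: "j \<in> {1..n}" using bij l by (auto simp: bij_betw_def)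
  let ?R = "\<lambda>k. \<Prod>i\<in>{1..n} - {l}. matpow N (k (\<alpha> (cyc n i)) - 1) (e i) (a (\<alpha> (cyc n i)))"
  let ?P = "\<lambda>k. peval (mattr N) (block_deriv n \<alpha> k F)"
  let ?A = "\<lambda>d. matpow N d (e (n + 1)) (a j)" and ?B = "\<lambda>c. matpow N c (e l) (a (n + 1))"
  have ins: "{1..n+1} = insert (n + 1) {1..n}" by auto
  have insj: "{1..n} = insert j ({1..n} - {j})" using j by auto
  have R: "?R (k(j := d)) = ?R k" for k d
  proof (rule prod.cong [OF refl])
    fix i assume "i \<in> {1..n} - {l}"
    hence "\<alpha> (cyc n i) \<noteq> j" unfolding l(2) using l(1) by (rule perm_cyc_neq [OF assms(2)])
    thus "matpow N ((k(j := d)) (\<alpha> (cyc n i)) - 1) (e i) (a (\<alpha> (cyc n i))) =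
        matpow N (k (\<alpha> (cyc n i)) - 1) (e i) (a (\<alpha> (cyc n i)))" by simp
  qed
  have summand: "quiver_term N (n + 1) F a e (bracket n \<alpha> j) (k(n + 1 := c)) =
      ?B (c - 1) * ?A (k j - 1) * ?R k * ?P (k(j := k j + c))" for k c
    unfolding quiver_term_def arrow_entries_bracket [OF assms(1,2) l]
      block_deriv_bracket [OF assms(1,2) j] by (rule refl)
  have "(\<Sum>k\<in>{1..n+1} \<rightarrow>\<^sub>E {1..K}. quiver_term N (n + 1) F a e (bracket n \<alpha> j) k) =
      (\<Sum>k\<in>{1..n} \<rightarrow>\<^sub>E {1..K}. \<Sum>c\<in>{1..K}. ?B (c - 1) * ?A (k j - 1) * ?R k * ?P (k(j := k j + c)))"
    unfolding ins summand [symmetric] by (rule sum_PiE_insert) simp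
  also have "\<dots> = (\<Sum>h\<in>{1..n} - {j} \<rightarrow>\<^sub>E {1..K}. \<Sum>d\<in>{1..K}. \<Sum>c\<in>{1..K}.
      ?B (c - 1) * ?A (d - 1) * (?R h * ?P (h(j := d + c))))"
  proof -
    have "(\<Sum>k\<in>insert j ({1..n} - {j}) \<rightarrow>\<^sub>E {1..K}. \<Sum>c\<in>{1..K}.
          ?B (c - 1) * ?A (k j - 1) * ?R k * ?P (k(j := k j + c))) =
        (\<Sum>h\<in>{1..n} - {j} \<rightarrow>\<^sub>E {1..K}. \<Sum>d\<in>{1..K}. \<Sum>c\<in>{1..K}.
          ?B (c - 1) * ?A ((h(j := d)) j - 1) * ?R (h(j := d)) *
          ?P (h(j := d, j := (h(j := d)) j + c)))"
      by (rule sum_PiE_insert) simp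
    thus ?thesis unfolding insj [symmetric] R by (simp only: fun_upd_same fun_upd_upd mult.assoc)
  qed
  also have "\<dots> = (\<Sum>h\<in>{1..n} - {j} \<rightarrow>\<^sub>E {1..K}. \<Sum>m\<in>{1..K}.
      (\<Sum>i<m - 1. ?B i * ?A (m - 1 - 1 - i)) * (?R h * ?P (h(j := m))))"
  proof (rule sum.cong [OF refl], rule sum_split_exponent)
    fix h m assume "m > K"
    hence "block_deriv n \<alpha> (h(j := m)) F = 0"
      by (intro block_deriv_eq_0 [OF assms(1,2) vars j]) simp
    thus "?R h * ?P (h(j := m)) = 0" by (simp add: peval_0)
  qed
  also have "\<dots> = (\<Sum>k\<in>{1..n} \<rightarrow>\<^sub>E {1..K}.
      (\<Sum>i<k j - 1. ?B i * ?A (k j - 1 - 1 - i)) * ?R k * ?P k)"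
  proof -
    have "(\<Sum>k\<in>insert j ({1..n} - {j}) \<rightarrow>\<^sub>E {1..K}.
          (\<Sum>i<k j - 1. ?B i * ?A (k j - 1 - 1 - i)) * ?R k * ?P k) =
        (\<Sum>h\<in>{1..n} - {j} \<rightarrow>\<^sub>E {1..K}. \<Sum>m\<in>{1..K}.
          (\<Sum>i<(h(j := m)) j - 1. ?B i * ?A ((h(j := m)) j - 1 - 1 - i)) * ?R (h(j := m)) *
          ?P (h(j := m)))"
      by (rule sum_PiE_insert) simp
    thus ?thesis unfolding insj [symmetric] R by (simp only: fun_upd_same mult.assoc)
  qed
  finally show ?thesis unfolding mderiv_matpow [OF assms(3,4)] .
qed

text \<open>
  By the product rule, one more derivative hits either the polynomial, which adds an arrow and a
  block, or one of the arrows of the quiver, which it cuts in two. These are the quivers of the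
  permutations \<open>[\<alpha>, 0]\<close> and \<open>[\<alpha>, j]\<close> with \<open>j \<ge> 1\<close>.
\<close>

lemma mderiv_sum_quiver_term:
  assumes "n \<ge> 1" "\<alpha> permutes {1..n}" "a (n + 1) < N" "e (n + 1) < N"
    and vars: "\<Union> (set_mset ` Poly_Mapping.keys F) \<subseteq> {1..K}"
  shows "mderiv (a (n + 1), e (n + 1)) (\<Sum>k\<in>{1..n} \<rightarrow>\<^sub>E {1..K}. quiver_term N n F a e \<alpha> k) =
    (\<Sum>j\<in>{0..n}. \<Sum>k\<in>{1..n+1} \<rightarrow>\<^sub>E {1..K}. quiver_term N (n + 1) F a e (bracket n \<alpha> j) k)"
proof -
  let ?v = "(a (n + 1), e (n + 1))"
  let ?R = "\<lambda>k l. \<Prod>i\<in>{1..n} - {l}. matpow N (k (\<alpha> (cyc n i)) - 1) (e i) (a (\<alpha> (cyc n i)))"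
  let ?P = "\<lambda>k. peval (mattr N) (block_deriv n \<alpha> k F)"
  let ?S = "\<lambda>j. \<Sum>k\<in>{1..n+1} \<rightarrow>\<^sub>E {1..K}. quiver_term N (n + 1) F a e (bracket n \<alpha> j) k"
  have "mderiv ?v (quiver_term N n F a e \<alpha> k) =
      (\<Sum>l\<in>{1..n}. mderiv ?v (matpow N (k (\<alpha> (cyc n l)) - 1) (e l) (a (\<alpha> (cyc n l)))) *
        ?R k l * ?P k) + arrow_entries N n \<alpha> k a e * mderiv ?v (?P k)" for k
    unfolding quiver_term_def mderiv_mult arrow_entries_def mderiv_prod [OF finite_atLeastAtMost]
      sum_distrib_right by (rule refl)
  hence "mderiv ?v (\<Sum>k\<in>{1..n} \<rightarrow>\<^sub>E {1..K}. quiver_term N n F a e \<alpha> k) =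
      (\<Sum>l\<in>{1..n}. \<Sum>k\<in>{1..n} \<rightarrow>\<^sub>E {1..K}.
        mderiv ?v (matpow N (k (\<alpha> (cyc n l)) - 1) (e l) (a (\<alpha> (cyc n l)))) * ?R k l * ?P k) +
      (\<Sum>k\<in>{1..n} \<rightarrow>\<^sub>E {1..K}. arrow_entries N n \<alpha> k a e * mderiv ?v (?P k))"
    unfolding mderiv_sum by (simp only: sum.distrib) (subst sum.swap, rule refl)
  also have "(\<Sum>l\<in>{1..n}. \<Sum>k\<in>{1..n} \<rightarrow>\<^sub>E {1..K}.
        mderiv ?v (matpow N (k (\<alpha> (cyc n l)) - 1) (e l) (a (\<alpha> (cyc n l)))) * ?R k l * ?P k) =
      (\<Sum>l\<in>{1..n}. ?S (\<alpha> (cyc n l)))"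
    by (intro sum.cong refl sum_quiver_term_bracket [of n \<alpha> a N e F K, OF assms, symmetric])
  also have "\<dots> = (\<Sum>j\<in>{1..n}. ?S j)"
    by (rule sum.reindex_bij_betw [OF perm_cyc_bij [OF assms(2)]])
  also have "(\<Sum>k\<in>{1..n} \<rightarrow>\<^sub>E {1..K}. arrow_entries N n \<alpha> k a e * mderiv ?v (?P k)) = ?S 0"
    by (rule sum_quiver_term_bracket_0 [of n \<alpha> a N e F K, OF assms, symmetric])
  finally show ?thesis by (simp add: sum.atLeast_Suc_atMost add.commute)
qed

lemma sum_permutes_bracket:
  assumes "n \<ge> 1"
  shows "(\<Sum>\<beta> | \<beta> permutes {1..n+1}. g \<beta>) =
    (\<Sum>\<alpha> | \<alpha> permutes {1..n}. \<Sum>j\<in>{0..n}. g (bracket n \<alpha> j))"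
proof -
  have "bij_betw (\<lambda>(\<alpha>, j). bracket n \<alpha> j) ({\<alpha>. \<alpha> permutes {1..n}} \<times> {0..n})
      {\<beta>. \<beta> permutes {1..n+1}}"
    unfolding bij_betw_def
  proof
    show "inj_on (\<lambda>(\<alpha>, j). bracket n \<alpha> j) ({\<alpha>. \<alpha> permutes {1..n}} \<times> {0..n})"
    proof (rule inj_onI, clarify)
      fix \<alpha> j \<alpha>' j'
      assume "\<alpha> permutes {1..n}" "j \<in> {0..n}" "\<alpha>' permutes {1..n}" "j' \<in> {0..n}"
        and "bracket n \<alpha> j = bracket n \<alpha>' j'"
      thus "\<alpha> = \<alpha>' \<and> j = j'" by (intro bracket_inj [OF assms]) simp_all
    qed
    show "(\<lambda>(\<alpha>, j). bracket n \<alpha> j) ` ({\<alpha>. \<alpha> permutes {1..n}} \<times> {0..n}) =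
        {\<beta>. \<beta> permutes {1..n+1}}"
    proof (intro equalityI subsetI)
      fix \<beta> assume "\<beta> \<in> {\<beta>. \<beta> permutes {1..n+1}}"
      then obtain \<alpha> j where "\<alpha> permutes {1..n}" "j \<le> n" "bracket n \<alpha> j = \<beta>"
        using bracket_surj [OF assms] by blast
      thus "\<beta> \<in> (\<lambda>(\<alpha>, j). bracket n \<alpha> j) ` ({\<alpha>. \<alpha> permutes {1..n}} \<times> {0..n})" by force
    qed (use bracket_permutes [OF assms] in auto)
  qed
  from sum.reindex_bij_betw [OF this, of g, symmetric] show ?thesis
    by (simp add: sum.cartesian_product case_prod_unfold)
qed

text \<open>
  The variables of the polynomial bound the weights of the arrows; larger weights contribute
  nothing by \<open>block_deriv_eq_0\<close>.
\<close>

lemma fold_mderiv_peval: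
  assumes "n \<ge> 1" "\<And>i. i \<in> {1..n} \<Longrightarrow> a i < N \<and> e i < N"
    and vars: "\<Union> (set_mset ` Poly_Mapping.keys F) \<subseteq> {1..K}"
  shows "fold (\<lambda>i. mderiv (a i, e i)) [1..<n+1] (peval (mattr N) F) =
    (\<Sum>\<alpha> | \<alpha> permutes {1..n}. \<Sum>k\<in>{1..n} \<rightarrow>\<^sub>E {1..K}. quiver_term N n F a e \<alpha> k)"
  using assms(1,2)
proof (induction n rule: nat_induct_at_least)
  case base
  have lt: "a 1 < N" "e 1 < N" using base by auto
  have "{1..1} = {1::nat}" by auto
  have "(\<Sum>\<alpha> | \<alpha> permutes {1..1}. \<Sum>k\<in>{1..1} \<rightarrow>\<^sub>E {1..K}. quiver_term N 1 F a e \<alpha> k) =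
      (\<Sum>k\<in>{1..1} \<rightarrow>\<^sub>E {1..K}. quiver_term N 1 F a e id k)"
    unfolding \<open>{1..1} = {1}\<close> by simp
  also have "\<dots> = (\<Sum>c\<in>{1..K}. quiver_term N 1 F a e id ((\<lambda>_. undefined)(1 := c)))"
    unfolding \<open>{1..1} = {1}\<close> by (subst sum_PiE_insert) (simp_all add: fun_upd_def)
  also have "\<dots> = (\<Sum>c\<in>{1..K}. mderiv (a 1, e 1) (mattr N c) * peval (mattr N) (pdiff c F))"
  proof (rule sum.cong [OF refl])
    fix c
    have "block_deriv 1 id ((\<lambda>_. undefined)(1 := c)) F = of_nat c * pdiff c F"
      using fold_kderiv_insert [of "{}" "{1}" "(\<lambda>_. undefined)(1 := c)" F]
      by (simp add: block_deriv_def kderiv_def)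
    thus "quiver_term N 1 F a e id ((\<lambda>_. undefined)(1 := c)) =
        mderiv (a 1, e 1) (mattr N c) * peval (mattr N) (pdiff c F)"
      unfolding mderiv_mattr [OF lt]
      by (simp add: quiver_term_def arrow_entries_def cyc_def peval_of_nat_times)
  qed
  also have "\<dots> = mderiv (a 1, e 1) (peval (mattr N) F)"
    by (rule mderiv_peval [OF finite_atLeastAtMost vars, symmetric])
  also have "\<dots> = fold (\<lambda>i. mderiv (a i, e i)) [1..<1+1] (peval (mattr N) F)" by simp
  finally show ?case by (rule sym)
next
  case (Suc n)
  have lt: "a (n + 1) < N" "e (n + 1) < N" using Suc.prems [of "n + 1"] by auto
  have "[1..<Suc n + 1] = [1..<n+1] @ [n + 1]" by simp
  hence "fold (\<lambda>i. mderiv (a i, e i)) [1..<Suc n + 1] (peval (mattr N) F) =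
      mderiv (a (n + 1), e (n + 1)) (fold (\<lambda>i. mderiv (a i, e i)) [1..<n+1] (peval (mattr N) F))"
    by simp
  also have "fold (\<lambda>i. mderiv (a i, e i)) [1..<n+1] (peval (mattr N) F) =
      (\<Sum>\<alpha> | \<alpha> permutes {1..n}. \<Sum>k\<in>{1..n} \<rightarrow>\<^sub>E {1..K}. quiver_term N n F a e \<alpha> k)"
    by (rule Suc.IH) (use Suc.prems in auto)
  also have "mderiv (a (n + 1), e (n + 1)) \<dots> = (\<Sum>\<alpha> | \<alpha> permutes {1..n}. \<Sum>j\<in>{0..n}.
      \<Sum>k\<in>{1..n+1} \<rightarrow>\<^sub>E {1..K}. quiver_term N (n + 1) F a e (bracket n \<alpha> j) k)"
    unfolding mderiv_sum [of _ _ "{\<alpha>. \<alpha> permutes {1..n}}"]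
    by (intro sum.cong refl mderiv_sum_quiver_term Suc.hyps lt vars) simp_all
  also have "\<dots> = (\<Sum>\<beta> | \<beta> permutes {1..n+1}.
      \<Sum>k\<in>{1..n+1} \<rightarrow>\<^sub>E {1..K}. quiver_term N (n + 1) F a e \<beta> k)"
    by (rule sum_permutes_bracket [OF Suc.hyps, symmetric])
  finally show ?case by simp
qed


section \<open>The summations as polynomials\<close>

lemma ppolys_single_times:
  assumes "0 \<notin># l" "G \<in> ppolys"
  shows "Poly_Mapping.single l c * G \<in> ppolys"
proof -
  have "Poly_Mapping.keys (Poly_Mapping.single l c * G) \<subseteq>
      {a + b | a b. a \<in> Poly_Mapping.keys (Poly_Mapping.single l c) \<and> b \<in> Poly_Mapping.keys G}"
    by (rule keys_mult)
  thus ?thesis using assms by (auto simp: ppolys_def split: if_splits)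
qed

lemma ppolys_sum:
  assumes "\<And>i. i \<in> A \<Longrightarrow> G i \<in> ppolys"
  shows "(\<Sum>i\<in>A. G i) \<in> ppolys"
proof -
  have "F + G \<in> ppolys" if "F \<in> ppolys" "G \<in> ppolys" for F G
    using that Poly_Mapping.keys_add [of F G] by (auto simp: ppolys_def)
  moreover have "0 \<in> ppolys" by (simp add: ppolys_def)
  ultimately show ?thesis
    using assms by (induction A rule: infinite_finite_induct) auto
qed

lemma ppolys_prod_pvar_times:
  assumes "\<And>c. c \<in> A \<Longrightarrow> h c \<ge> 1" "G \<in> ppolys"
  shows "(\<Prod>c\<in>A. pvar (h c)) * G \<in> ppolys"
  using assms
proof (induction A arbitrary: G rule: infinite_finite_induct)
  case (insert x A)
  have "h x \<noteq> 0" using insert.prems(1) [of x] by simp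
  hence "pvar (h x) * G \<in> ppolys"
    unfolding pvar_def by (intro ppolys_single_times insert.prems) simp
  hence "(\<Prod>c\<in>A. pvar (h c)) * (pvar (h x) * G) \<in> ppolys"
    using insert by blast
  thus ?case using insert.hyps by (simp add: ac_simps)
qed simp_all

lemma ppolys_iff_vars: "F \<in> ppolys \<longleftrightarrow> 0 \<notin> \<Union> (set_mset ` Poly_Mapping.keys F)"
  by (auto simp: ppolys_def)

lemma cycle_supports_sum_pos:
  fixes k :: "nat \<Rightarrow> nat"
  assumes "\<alpha> permutes {1..n}" "k \<in> {1..n} \<rightarrow>\<^sub>E {1..}" "c \<in> cycle_supports n \<alpha>"
  shows "(\<Sum>t\<in>c. k t) \<ge> 1"
proof -
  obtain i where i: "i \<in> {1..n}" "c = orbit \<alpha> i" using assms(3) by (auto simp: cycle_supports_def)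
  have sub: "c \<subseteq> {1..n}" unfolding i(2) using assms(1) i(1) by (rule permutes_orbit_subset)
  have t: "\<alpha> i \<in> c" unfolding i(2) by (rule orbit.base)
  have "k (\<alpha> i) \<ge> 1" using assms(2) sub t by (auto simp: PiE_iff)
  also have "k (\<alpha> i) \<le> (\<Sum>t\<in>c. k t)"
    using t by (intro member_le_sum) (auto intro: finite_subset [OF sub])
  finally show ?thesis .
qed

lemma FS_in_ppolys:
  assumes "n \<ge> 1" "\<alpha> permutes {1..n}" "F \<in> ppolys"
  shows "FS n \<alpha> F \<in> ppolys"
  unfolding FS_def
proof (intro ppolys_single_times ppolys_sum)
  fix k assume "k \<in> {k \<in> {1..n} \<rightarrow>\<^sub>E {1..}. FS_term n \<alpha> k F \<noteq> 0}"
  hence k: "k \<in> {1..n} \<rightarrow>\<^sub>E {1..}" by simp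
  have "Finite_Set.fold (kderiv k) F (setpart n \<alpha>) \<in> ppolys"
    using fold_kderiv_vars [of "setpart n \<alpha>" k F] setpart_finite_Union [OF assms(1,2)] assms(3)
    unfolding ppolys_iff_vars by blast
  thus "FS_term n \<alpha> k F \<in> ppolys"
    unfolding FS_term_def using cycle_supports_sum_pos [OF assms(2) k]
    by (intro ppolys_prod_pvar_times)
qed simp

text \<open>
  The indeterminate of index \<open>0\<close> has to be excluded: \<^term>\<open>psum 0\<close> is the empty product \<open>1\<close>, but the
  trace of the \<open>0\<close>-th power of the truncated matrix is \<open>N\<close>.
\<close>

lemma trunc_ev: "F \<in> ppolys \<Longrightarrow> trunc N (ev F) = peval (mattr N) F"
  unfolding ev_eq_peval trunc_peval unfolding peval_def
  by (intro sum.cong refl arg_cong2 [where f = times] arg_cong [where f = prod_mset]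
        image_mset_cong trunc_psum)
     (auto simp: ppolys_def Suc_le_eq intro!: Nat.gr0I)

lemma trunc_ev_FS:
  assumes "n \<ge> 1" "\<alpha> permutes {1..n}" "F \<in> ppolys"
    and vars: "\<Union> (set_mset ` Poly_Mapping.keys F) \<subseteq> {1..K}"
  shows "trunc N (ev (FS n \<alpha> F)) = mconst (1 / of_nat n) * (\<Sum>k\<in>{1..n} \<rightarrow>\<^sub>E {1..K}.
    (\<Prod>c\<in>orbit \<alpha> ` {1..n}. mattr N (\<Sum>t\<in>c. k t)) * peval (mattr N) (block_deriv n \<alpha> k F))"
proof -
  have "(\<Sum>k \<in> {k \<in> {1..n} \<rightarrow>\<^sub>E {1..}. FS_term n \<alpha> k F \<noteq> 0}. FS_term n \<alpha> k F) =
      (\<Sum>k\<in>{1..n} \<rightarrow>\<^sub>E {1..K}. FS_term n \<alpha> k F)"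
  proof (rule sum.mono_neutral_left)
    show "{k \<in> {1..n} \<rightarrow>\<^sub>E {1..}. FS_term n \<alpha> k F \<noteq> 0} \<subseteq> {1..n} \<rightarrow>\<^sub>E {1..K}"
    proof clarify
      fix k assume k: "k \<in> {1..n} \<rightarrow>\<^sub>E {1..}" "FS_term n \<alpha> k F \<noteq> 0"
      have "k t \<le> K" if "t \<in> {1..n}" for t
        using block_deriv_eq_0 [OF assms(1,2) vars that, of k] k(2)
        by (force simp: FS_term_def block_deriv_def)
      thus "k \<in> {1..n} \<rightarrow>\<^sub>E {1..K}" using k(1) by (auto simp: PiE_iff)
    qed
    show "\<forall>k\<in>({1..n} \<rightarrow>\<^sub>E {1..K}) - {k \<in> {1..n} \<rightarrow>\<^sub>E {1..}. FS_term n \<alpha> k F \<noteq> 0}.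
        FS_term n \<alpha> k F = 0"
      by (auto simp: PiE_iff)
  qed (simp add: finite_PiE)
  hence "peval (mattr N) (FS n \<alpha> F) = mconst (1 / of_nat n) *
      peval (mattr N) (\<Sum>k\<in>{1..n} \<rightarrow>\<^sub>E {1..K}. FS_term n \<alpha> k F)"
    by (simp add: FS_def peval_single_times)
  thus ?thesis
    unfolding trunc_ev [OF FS_in_ppolys [OF assms(1-3)]] peval_sum FS_term_def
      peval_prod_pvar_times cycle_supports_def block_deriv_def .
qed

text \<open>
  The factors \<open>X\<close> in front of the derivatives complete the powers along the arrows. The index \<open>a\<^sub>1\<close>
  serves the vertices \<open>1\<close> and \<open>n + 1\<close> at once, so the chain of the quiver closes to a cycle and the
  sum over the row indices runs along the cycles of \<open>\<alpha>\<close>.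
\<close>

lemma sum_contract_quiver_term:
  assumes "\<alpha> permutes {1..n}" "k \<in> {1..n} \<rightarrow>\<^sub>E {1..K}"
  shows "(\<Sum>a\<in>{1..n} \<rightarrow>\<^sub>E {..<N}. \<Sum>e\<in>{1..n} \<rightarrow>\<^sub>E {..<N}.
      (\<Prod>i\<in>{1..n}. mvar (a (cyc n i), e i)) * quiver_term N n F a e \<alpha> k) =
    (\<Prod>c\<in>orbit \<alpha> ` {1..n}. mattr N (\<Sum>t\<in>c. k t)) * peval (mattr N) (block_deriv n \<alpha> k F)"
proof -
  have "(\<Sum>e\<in>{1..n} \<rightarrow>\<^sub>E {..<N}. (\<Prod>i\<in>{1..n}. mvar (a (cyc n i), e i)) * arrow_entries N n \<alpha> k a e) =
      (\<Prod>i\<in>{1..n}. matpow N (k (\<alpha> i)) (a i) (a (\<alpha> i)))" for a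
  proof -
    have "(\<Sum>e\<in>{1..n} \<rightarrow>\<^sub>E {..<N}. (\<Prod>i\<in>{1..n}. mvar (a (cyc n i), e i)) * arrow_entries N n \<alpha> k a e) =
        (\<Prod>i\<in>{1..n}. \<Sum>c<N. mvar (a (cyc n i), c) *
          matpow N (k (\<alpha> (cyc n i)) - 1) c (a (\<alpha> (cyc n i))))"
      unfolding arrow_entries_def prod.distrib [symmetric]
      by (rule prod_sum_PiE [symmetric]) simp_all
    also have "\<dots> = (\<Prod>i\<in>{1..n}. matpow N (k (\<alpha> (cyc n i))) (a (cyc n i)) (a (\<alpha> (cyc n i))))"
    proof (rule prod.cong [OF refl])
      fix i assume "i \<in> {1..n}"
      hence "\<alpha> (cyc n i) \<in> {1..n}" using perm_cyc_bij [OF assms(1)] by (auto simp: bij_betw_def)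
      hence "k (\<alpha> (cyc n i)) \<ge> 1" using assms(2) by (auto simp: PiE_iff)
      then obtain d where "k (\<alpha> (cyc n i)) = Suc d" by (cases "k (\<alpha> (cyc n i))") auto
      thus "(\<Sum>c<N. mvar (a (cyc n i), c) * matpow N (k (\<alpha> (cyc n i)) - 1) c (a (\<alpha> (cyc n i)))) =
          matpow N (k (\<alpha> (cyc n i))) (a (cyc n i)) (a (\<alpha> (cyc n i)))" by simp
    qed
    also have "\<dots> = (\<Prod>i\<in>{1..n}. matpow N (k (\<alpha> i)) (a i) (a (\<alpha> i)))"
      by (rule prod.reindex_bij_betw [OF cyc_bij])
    finally show ?thesis .
  qed
  hence "(\<Sum>a\<in>{1..n} \<rightarrow>\<^sub>E {..<N}. \<Sum>e\<in>{1..n} \<rightarrow>\<^sub>E {..<N}.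
      (\<Prod>i\<in>{1..n}. mvar (a (cyc n i), e i)) * arrow_entries N n \<alpha> k a e) =
    (\<Prod>c\<in>orbit \<alpha> ` {1..n}. mattr N (\<Sum>t\<in>c. k t))"
    by (simp only: sum_prod_matpow [OF finite_atLeastAtMost assms(1)])
  thus ?thesis
    unfolding quiver_term_def mult.assoc [symmetric] sum_distrib_right [symmetric] by simp
qed

lemma sum_swap_last:
  "(\<Sum>a\<in>A. \<Sum>b\<in>B. \<Sum>c\<in>C. h a b c) = (\<Sum>c\<in>C. \<Sum>a\<in>A. \<Sum>b\<in>B. h a b c)"
proof -
  have "(\<Sum>a\<in>A. \<Sum>b\<in>B. \<Sum>c\<in>C. h a b c) = (\<Sum>a\<in>A. \<Sum>c\<in>C. \<Sum>b\<in>B. h a b c)"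
    by (intro sum.cong refl sum.swap)
  also have "\<dots> = (\<Sum>c\<in>C. \<Sum>a\<in>A. \<Sum>b\<in>B. h a b c)" by (rule sum.swap)
  finally show ?thesis .
qed

lemma Wop_ev:
  assumes "n \<ge> 1" "F \<in> ppolys"
  shows "Wop n (ev F) = (\<Sum>\<alpha> | \<alpha> permutes {1..n}. ev (FS n \<alpha> F))"
proof (rule mfps_eqI_trunc)
  fix N :: nat
  let ?V = "\<Union> (set_mset ` Poly_Mapping.keys F)" and ?I = "{1..n} \<rightarrow>\<^sub>E {..<N}"
  let ?X = "\<lambda>a e. \<Prod>i\<in>{1..n}. mvar (a (cyc n i), e i)"
  define K where "K = Max ?V"
  have vars: "?V \<subseteq> {1..K}"
  proof
    fix v assume v: "v \<in> ?V"
    hence "v \<noteq> 0" using assms(2) unfolding ppolys_iff_vars by metis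
    moreover have "v \<le> K" unfolding K_def using v by (intro Max_ge) simp_all
    ultimately show "v \<in> {1..K}" by simp
  qed
  have "(\<Sum>a\<in>?I. \<Sum>e\<in>?I. ?X a e * fold (\<lambda>i. mderiv (a i, e i)) [1..<n+1] (peval (mattr N) F)) =
      (\<Sum>a\<in>?I. \<Sum>e\<in>?I. ?X a e * (\<Sum>\<alpha> | \<alpha> permutes {1..n}. \<Sum>k\<in>{1..n} \<rightarrow>\<^sub>E {1..K}.
        quiver_term N n F a e \<alpha> k))"
    by (intro sum.cong refl arg_cong2 [where f = times] fold_mderiv_peval [OF assms(1) _ vars])
       (auto simp: PiE_iff)
  also have "\<dots> = (\<Sum>\<alpha> | \<alpha> permutes {1..n}. \<Sum>k\<in>{1..n} \<rightarrow>\<^sub>E {1..K}. \<Sum>a\<in>?I. \<Sum>e\<in>?I.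
      ?X a e * quiver_term N n F a e \<alpha> k)"
    unfolding sum_distrib_left sum_swap_last [where C = "{\<alpha>. \<alpha> permutes {1..n}}"]
      sum_swap_last [where C = "{1..n} \<rightarrow>\<^sub>E {1..K}"] by (rule refl)
  also have "\<dots> = (\<Sum>\<alpha> | \<alpha> permutes {1..n}. \<Sum>k\<in>{1..n} \<rightarrow>\<^sub>E {1..K}.
      (\<Prod>c\<in>orbit \<alpha> ` {1..n}. mattr N (\<Sum>t\<in>c. k t)) * peval (mattr N) (block_deriv n \<alpha> k F))"
    by (intro sum.cong refl sum_contract_quiver_term) simp_all
  finally have "trunc N (Wop n (ev F)) = (\<Sum>\<alpha> | \<alpha> permutes {1..n}.
      mconst (1 / of_nat n) * (\<Sum>k\<in>{1..n} \<rightarrow>\<^sub>E {1..K}.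
        (\<Prod>c\<in>orbit \<alpha> ` {1..n}. mattr N (\<Sum>t\<in>c. k t)) * peval (mattr N) (block_deriv n \<alpha> k F)))"
    unfolding trunc_Wop trunc_ev [OF assms(2)] by (simp only: sum_distrib_left)
  also have "\<dots> = trunc N (\<Sum>\<alpha> | \<alpha> permutes {1..n}. ev (FS n \<alpha> F))"
    unfolding trunc_sum
    by (intro sum.cong refl trunc_ev_FS [OF assms(1) _ assms(2) vars, symmetric]) simp
  finally show "trunc N (Wop n (ev F)) = trunc N (\<Sum>\<alpha> | \<alpha> permutes {1..n}. ev (FS n \<alpha> F))" .
qed

theorem theorem3p7:
  fixes n :: nat
  assumes "n \<ge> 1"
  shows "(\<forall>f\<in>pring. Wop n f \<in> pring) \<and>
         (\<forall>F\<in>ppolys. Wop n (ev F) = (\<Sum>\<alpha> | \<alpha> permutes {1..n}. ev (FS n \<alpha> F)))"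
proof -
  have "Wop n (ev F) \<in> pring" if "F \<in> ppolys" for F
  proof -
    have "Wop n (ev F) = ev (\<Sum>\<alpha> | \<alpha> permutes {1..n}. FS n \<alpha> F)"
      using Wop_ev [OF assms that] by (simp only: ev_eq_peval peval_sum)
    moreover have "(\<Sum>\<alpha> | \<alpha> permutes {1..n}. FS n \<alpha> F) \<in> ppolys"
      using FS_in_ppolys [OF assms _ that] by (intro ppolys_sum) simp
    ultimately show ?thesis by (simp add: pring_def)
  qed
  thus ?thesis using Wop_ev [OF assms] by (auto simp: pring_def)
qed

end
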